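(* Let $\xi,\xi_1,\xi_2,\ldots$ be independent and identically distributed real random variables with finite mean $a:=\mathbb{E}\xi>0$. Let $S_0=0$, $S_n=\xi_1+\ldots+\xi_n$ for $n\ge 1$, and $M_n=\max_{0\le i\le n}S_i$. Let $\tau$ be a counting random variable, with arbitrary dependence between $\tau$ and $\{\xi_n\}$, whose distribution is intermediate regularly varying at infinity. (1) If $$x\,\mathbb{P}\{\xi>x\} = o(\mathbb{P}\{\tau>x\})\quad\text{as }x\to\infty, \qquad (\mathrm{U})$$ then $$\mathbb{P}\{M_\tau>x\}\ \le\ (1+o(1))\,\mathbb{P}\{\tau>x/a\}\quad\text{as }x\to\infty.$$ (2) If $$\int_x^\infty \mathbb{P}\{\xi<-y\}\,dy = o(\mathbb{P}\{\tau>x\})\quad\text{as }x\to\infty, \qquad (\mathrm{L})$$ then $$\mathbb{P}\{S_\tau>x\}\ \ge\ (1+o(1))\,\mathbb{P}\{\tau>x/a\}\quad\text{as }x\to\infty.$$ (3) If both (U) and (L) hold, then $$\mathbb{P}\{M_\tau>x\}\ \sim\ \mathbb{P}\{S_\tau>x\}\ \sim\ \mathbb{P}\{\tau>x/a\}\quad\text{as }x\to\infty.$$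
   Context: A counting random variable is a random variable with values in the non-negative integers (defined on the same probability space as $\{\xi_n\}$). For eventually positive functions $f,g$: $f(x)\sim g(x)$ means $f(x)/g(x)\to1$ as $x\to\infty$, and $f(x)=o(g(x))$ means $f(x)/g(x)\to 0$ as $x\to\infty$ (for the latter $f$ need only be non-negative). The relation $f(x)\le(1+o(1))g(x)$ means $\limsup_{x\to\infty}f(x)/g(x)\le1$, and $f(x)\ge(1+o(1))g(x)$ means $\liminf_{x\to\infty}f(x)/g(x)\ge1$. Intermediate regular variation: a distribution $G$ with tail $\overline G(x)=G((x,\infty))$, positive for all $x$, is intermediate regularly varying at infinity if $$\lim_{\varepsilon\downarrow0}\limsup_{x\to\infty}\frac{\overline G((1-\varepsilon)x)}{\overline G(x)}=1.$$ *)

theory Defs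
  imports "HOL-Probability.Probability" "HOL-Library.Landau_Symbols"
begin

definition random_walk :: "(nat \<Rightarrow> 'a \<Rightarrow> real) \<Rightarrow> nat \<Rightarrow> 'a \<Rightarrow> real" where
  "random_walk \<xi> n \<omega> = (\<Sum>i=1..n. \<xi> i \<omega>)"

definition running_max :: "(nat \<Rightarrow> 'a \<Rightarrow> real) \<Rightarrow> nat \<Rightarrow> 'a \<Rightarrow> real" where
  "running_max \<xi> n \<omega> = Max ((\<lambda>i. random_walk \<xi> i \<omega>) ` {0..n})"

definition tail :: "real measure \<Rightarrow> real \<Rightarrow> real" where
  "tail G x = measure G {x<..}"

(* The limits superior are taken in the extended reals, since they may be infinite. *)
definition intermediate_regularly_varying :: "real measure \<Rightarrow> bool" where
  "intermediate_regularly_varying G \<longleftrightarrow>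
     (\<forall>x. tail G x > 0) \<and>
     ((\<lambda>\<epsilon>. Limsup at_top (\<lambda>x. ereal (tail G ((1 - \<epsilon>) * x) / tail G x))) \<longlongrightarrow> 1) (at_right 0)"

(* The relations f(x) <= (1 + o(1)) g(x) and f(x) >= (1 + o(1)) g(x) as x tends to infinity,
   for eventually positive g. *)
definition asymp_le :: "(real \<Rightarrow> real) \<Rightarrow> (real \<Rightarrow> real) \<Rightarrow> bool" where
  "asymp_le f g \<longleftrightarrow> Limsup at_top (\<lambda>x. ereal (f x / g x)) \<le> 1"

definition asymp_ge :: "(real \<Rightarrow> real) \<Rightarrow> (real \<Rightarrow> real) \<Rightarrow> bool" where
  "asymp_ge f g \<longleftrightarrow> Liminf at_top (\<lambda>x. ereal (f x / g x)) \<ge> 1"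

end

theory Submission
  imports Defs "HOL-Real_Asymp.Real_Asymp"
begin

text \<open>
Write $p(x)$ for the tail of $\tau$. If $\tau \le (1-\epsilon)x/a$ then $M_\tau > x$ forces the walk to
pass $x$ within its first $(1-\epsilon)x/a$ steps; if $\tau > x/(a(1-\epsilon))$ then $S_\tau \le x$
forces it to be at or below $x$ at some time after $x/(a(1-\epsilon))$. Both events concern the walk
alone, whatever the dependence between $\tau$ and the walk, and both have probability $o(p(x))$
(\<open>early_passage_smallo\<close>, \<open>late_low_value_smallo\<close>). Intermediate regular
variation then absorbs the factor $1-\epsilon$.

Both events are ruin events for a walk whose steps $\zeta$ have positive mean: it starts at a level
proportional to $x$ and has to reach the negative half-line. In the early case
$\zeta = a + d - \xi$ for a small $d > 0$, and steps below $-x$ are cut off at $-x$; that changes the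
walk with probability at most $(x/a) P(\xi > x)$, which is where (U) enters. In the late case
$\zeta = \xi - (a - d)$ over an unbounded horizon, and (L) controls the integrated left tail of
$\zeta$.

The ruin probability is bounded by a Lyapunov function. Put $Z = \max(1, -\zeta)$ and
$$H(u) = E\, Z \Bigl(\frac{Z}{Z+u}\Bigr)^m, \qquad
  G(u) = E\, \Bigl(\frac{Z}{Z+u}\Bigr)^{m+1} = -H'(u)/m .$$
Up to constants, $H$ is a smoothed version of the integrated left tail of $\zeta$. Unlike the tail of
$\zeta$ itself, $G$ changes only by a bounded factor when $u$ is halved and hardly at all under
bounded shifts of a large $u$, while still $P(\zeta < -u/2) \le 3^{m+1} G(u)$. A step of the walk
changes $H$ by roughly $-m G(u) \zeta$, so positive drift outweighs all other contributions and
$\min(1, C H)$ is superharmonic for large $C$ (\<open>lyapunov_drift\<close>); stopping the walk at ruin gives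
$P(\text{ruin from } u) \le C H(u)$. The constant $C$ is the same for all step variables that lie above
$\zeta$ (\<open>ex_uniform_ruin_bound\<close>), in particular for $\zeta$ cut off at any level.

It remains to see that $H = o(p)$. Splitting according to whether $Z > u/2$ gives
$H(u) \le E[-\zeta; \zeta < -u/2] + (2/3)^m H(u/2)$. The first term is $o(p)$ by hypothesis, and as
$p(u/2) \le K p(u)$, the factor $(2/3)^m$ with $m$ large makes the recursion contracting relative
to $p$ (\<open>smallo_of_halving_recursion\<close>). The same argument applied to the expectation without the
factor $Z$ serves the early case.
\<close>

section \<open>The potential of a step distribution\<close>

text \<open>
The cut at 1 keeps the potential below from vanishing when there are no negative steps. Then a
multiple of the potential exceeds 1 on any given bounded interval, with a factor that does not
depend on the step distribution.
\<close>
definition excess :: "real \<Rightarrow> real" where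
  "excess w = max 1 (- w)"

definition potential :: "'a measure \<Rightarrow> nat \<Rightarrow> ('a \<Rightarrow> real) \<Rightarrow> real \<Rightarrow> real" where
  "potential M m \<zeta> u = (\<integral>\<omega>. excess (\<zeta> \<omega>) * (excess (\<zeta> \<omega>) / (excess (\<zeta> \<omega>) + u)) ^ m \<partial>M)"

text \<open>
Up to the factor \<open>m\<close>, the derivative of \<open>potential M m \<zeta>\<close> is minus \<open>potential_slope M (Suc m) \<zeta>\<close>.
\<close>
definition potential_slope :: "'a measure \<Rightarrow> nat \<Rightarrow> ('a \<Rightarrow> real) \<Rightarrow> real \<Rightarrow> real" where
  "potential_slope M m \<zeta> u = (\<integral>\<omega>. (excess (\<zeta> \<omega>) / (excess (\<zeta> \<omega>) + u)) ^ m \<partial>M)"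

text \<open>
The cap at 1 makes ruin, that is, arrival at a level \<open>u \<le> 0\<close>, the worst outcome of a step.
\<close>
definition lyapunov :: "'a measure \<Rightarrow> nat \<Rightarrow> ('a \<Rightarrow> real) \<Rightarrow> real \<Rightarrow> real \<Rightarrow> real" where
  "lyapunov M m \<zeta> C u = (if u \<le> 0 then 1 else min 1 (C * potential M m \<zeta> u))"

lemma excess_ge_1: "1 \<le> excess w"
  by (simp add: excess_def)

lemma excess_pos: "0 < excess w"
  by (simp add: excess_def)

lemma borel_measurable_excess [measurable]: "excess \<in> borel_measurable borel"
  unfolding excess_def by measurable

text \<open>
The kernel is convex in \<open>u\<close>, so it lies above its tangent at \<open>u + t\<close>, for either sign of \<open>t\<close>.
Taking the tangent at the new point rather than at \<open>u\<close> is what bounds the kernel after a step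
from above. Written with the ratio \<open>(z + u + t) / (z + u)\<close>, this is Bernoulli's inequality.
\<close>
lemma kernel_tangent_bound:
  fixes z u t :: real
  assumes "z > 0" "u > 0" "u + t > 0"
  shows "z * (z / (z + (u + t))) ^ m
    \<le> z * (z / (z + u)) ^ m - t * real m * (z / (z + (u + t))) ^ Suc m"
proof -
  define A where "A = z + u"
  define B where "B = z + (u + t)"
  have AB: "A > 0" "B > 0" "t = B - A" using assms by (auto simp: A_def B_def)
  have "1 + real m * (B / A - 1) \<le> (B / A) ^ m"
    using Bernoulli_inequality[of "B / A - 1" m] AB by simp
  moreover have "1 - A / B \<le> B / A - 1"
  proof -
    have "B / A - 1 - (1 - A / B) = (B - A)\<^sup>2 / (A * B)"
      using AB by (simp add: field_simps power2_eq_square)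
    also have "\<dots> \<ge> 0" using AB by simp
    finally show ?thesis by simp
  qed
  then have "real m * (1 - A / B) \<le> real m * (B / A - 1)"
    by (rule mult_left_mono) simp
  ultimately have le: "1 \<le> (B / A) ^ m - real m * (1 - A / B)" by linarith
  have "z * (z / B) ^ m * 1 \<le> z * (z / B) ^ m * ((B / A) ^ m - real m * (1 - A / B))"
    using le by (rule mult_left_mono) (use assms AB in simp)
  also have "\<dots> = z * ((z / B) * (B / A)) ^ m - t * real m * (z / B) ^ Suc m"
  proof -
    have "z * (1 - A / B) = t * (z / B)"
      unfolding AB(3) using AB(1,2) by (simp add: field_simps)
    have "z * (z / B) ^ m * (real m * (1 - A / B)) = z * (1 - A / B) * (real m * (z / B) ^ m)"
      by (simp only: mult_ac)
    also have "\<dots> = t * real m * (z / B) ^ Suc m"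
      unfolding \<open>z * (1 - A / B) = t * (z / B)\<close> by (simp only: power_Suc mult_ac)
    finally show ?thesis by (simp only: power_mult_distrib right_diff_distrib mult.assoc)
  qed
  also have "(z / B) * (B / A) = z / A" using AB by simp
  finally show ?thesis by (simp add: A_def B_def)
qed

text \<open>
This gives both regularity properties of the slope: a bounded factor for \<open>v = u / 2\<close>, and a factor
close to 1 when \<open>u - v\<close> is bounded and \<open>u\<close> is large.
\<close>
lemma kernel_scaling_bound:
  fixes z u v :: real
  assumes "z > 0" "0 < v" "v \<le> u"
  shows "(z / (z + v)) ^ m \<le> (u / v) ^ m * (z / (z + u)) ^ m"
proof -
  have "v * (z + u) \<le> u * (z + v)"
    using assms by (simp add: algebra_simps mult_right_mono)
  then have "z * (v * (z + u)) \<le> z * (u * (z + v))"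
    using assms(1) by (intro mult_left_mono) auto
  then have "z / (z + v) \<le> (z * u) / (v * (z + u))"
    using assms by (simp add: pos_divide_le_eq pos_le_divide_eq mult_ac)
  then have "z / (z + v) \<le> (u / v) * (z / (z + u))"
    by (simp add: mult_ac)
  then have "(z / (z + v)) ^ m \<le> ((u / v) * (z / (z + u))) ^ m"
    using assms by (intro power_mono) auto
  then show ?thesis by (simp only: power_mult_distrib)
qed

text \<open>
For \<open>z \<le> u / 2\<close> the base \<open>z / (z + u)\<close> is at most two thirds of its value at \<open>u / 2\<close>. The gain of
\<open>(2 / 3) ^ m\<close> per halving is the reason for taking a power.
\<close>
lemma kernel_halving_bound:
  fixes z u :: real
  assumes "z > 0" "u > 0"
  shows "(z / (z + u)) ^ m \<le> of_bool (z > u / 2) + (2 / 3) ^ m * (z / (z + u / 2)) ^ m"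
proof (cases "z > u / 2")
  case True
  have "(z / (z + u)) ^ m \<le> 1" using assms by (intro power_le_one) auto
  moreover have "0 \<le> (2 / 3) ^ m * (z / (z + u / 2)) ^ m" using assms by simp
  ultimately show ?thesis using True by simp
next
  case False
  have "z / (z + u) \<le> (2 / 3) * (z / (z + u / 2))"
    using assms False by (simp add: field_simps)
  then have "(z / (z + u)) ^ m \<le> ((2 / 3) * (z / (z + u / 2))) ^ m"
    using assms by (intro power_mono) auto
  then show ?thesis using False by (simp only: power_mult_distrib) simp
qed

context prob_space
begin

lemma kernel_le_1: "u \<ge> 0 \<Longrightarrow> (excess w / (excess w + u)) ^ m \<le> 1"
  using excess_pos[of w] by (intro power_le_one) auto

lemma kernel_nonneg: "u \<ge> 0 \<Longrightarrow> 0 \<le> (excess w / (excess w + u)) ^ m"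
  using excess_pos[of w] by simp

lemma integrable_excess:
  "integrable M \<zeta> \<Longrightarrow> integrable M (\<lambda>\<omega>. excess (\<zeta> \<omega>))"
  unfolding excess_def by (intro integrable_max) auto

lemma integrable_slope_kernel:
  assumes [measurable]: "\<zeta> \<in> borel_measurable M" and "u \<ge> 0"
  shows "integrable M (\<lambda>\<omega>. (excess (\<zeta> \<omega>) / (excess (\<zeta> \<omega>) + u)) ^ m)"
proof (rule integrable_const_bound[where B = 1])
  show "AE \<omega> in M. norm ((excess (\<zeta> \<omega>) / (excess (\<zeta> \<omega>) + u)) ^ m) \<le> 1"
    using kernel_le_1[OF assms(2)] kernel_nonneg[OF assms(2)] by (simp del: power_divide)
qed measurable

lemma integrable_potential_kernel:
  assumes "integrable M \<zeta>" and "u \<ge> 0"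
  shows "integrable M (\<lambda>\<omega>. excess (\<zeta> \<omega>) * (excess (\<zeta> \<omega>) / (excess (\<zeta> \<omega>) + u)) ^ m)"
proof (rule Bochner_Integration.integrable_bound[OF integrable_excess[OF assms(1)]])
  have [measurable]: "\<zeta> \<in> borel_measurable M" using assms(1) by auto
  show "(\<lambda>\<omega>. excess (\<zeta> \<omega>) * (excess (\<zeta> \<omega>) / (excess (\<zeta> \<omega>) + u)) ^ m) \<in> borel_measurable M"
    by measurable
  show "AE \<omega> in M. norm (excess (\<zeta> \<omega>) * (excess (\<zeta> \<omega>) / (excess (\<zeta> \<omega>) + u)) ^ m) \<le> norm (excess (\<zeta> \<omega>))"
    using kernel_le_1[OF assms(2)] kernel_nonneg[OF assms(2)] excess_pos
    by (simp del: power_divide add: abs_mult mult_left_le)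
qed

lemma borel_measurable_potential [measurable]:
  assumes [measurable]: "\<zeta> \<in> borel_measurable M"
  shows "potential M m \<zeta> \<in> borel_measurable borel"
  unfolding potential_def by measurable

lemma potential_tangent_bound:
  assumes \<zeta>: "integrable M \<zeta>" and "u > 0" "u + t > 0"
  shows "potential M m \<zeta> (u + t) \<le> potential M m \<zeta> u - t * real m * potential_slope M (Suc m) \<zeta> (u + t)"
proof -
  have [measurable]: "\<zeta> \<in> borel_measurable M" using \<zeta> by auto
  note int = integrable_potential_kernel[OF \<zeta>, of u m] integrable_potential_kernel[OF \<zeta>, of "u + t" m]
    integrable_slope_kernel[of \<zeta> "u + t" "Suc m"]
  have "potential M m \<zeta> (u + t)
    \<le> (\<integral>\<omega>. excess (\<zeta> \<omega>) * (excess (\<zeta> \<omega>) / (excess (\<zeta> \<omega>) + u)) ^ m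
         - t * real m * (excess (\<zeta> \<omega>) / (excess (\<zeta> \<omega>) + (u + t))) ^ Suc m \<partial>M)"
    unfolding potential_def
    by (intro integral_mono Bochner_Integration.integrable_diff integrable_mult_right int
        kernel_tangent_bound excess_pos assms less_imp_le) (use assms in auto)
  also have "\<dots> = potential M m \<zeta> u - t * real m * potential_slope M (Suc m) \<zeta> (u + t)"
    unfolding potential_def potential_slope_def
    by (subst Bochner_Integration.integral_diff) (use int assms in \<open>auto simp del: power_divide power_Suc\<close>)
  finally show ?thesis .
qed

lemma potential_slope_scaling_bound:
  assumes [measurable]: "\<zeta> \<in> borel_measurable M" and "0 < v" "v \<le> u"
  shows "potential_slope M m \<zeta> v \<le> (u / v) ^ m * potential_slope M m \<zeta> u"
proof -
  have "potential_slope M m \<zeta> v \<le> (\<integral>\<omega>. (u / v) ^ m * (excess (\<zeta> \<omega>) / (excess (\<zeta> \<omega>) + u)) ^ m \<partial>M)"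
    unfolding potential_slope_def
    by (intro integral_mono integrable_mult_right integrable_slope_kernel kernel_scaling_bound excess_pos assms)
      (use assms in auto)
  then show ?thesis unfolding potential_slope_def by (simp only: integral_mult_right_zero)
qed

lemma potential_slope_antimono:
  assumes [measurable]: "\<zeta> \<in> borel_measurable M" and "0 \<le> v" "v \<le> u"
  shows "potential_slope M m \<zeta> u \<le> potential_slope M m \<zeta> v"
  unfolding potential_slope_def
proof (intro integral_mono integrable_slope_kernel power_mono divide_left_mono)
  fix \<omega> show "0 < (excess (\<zeta> \<omega>) + u) * (excess (\<zeta> \<omega>) + v)" "0 \<le> excess (\<zeta> \<omega>) / (excess (\<zeta> \<omega>) + u)" "0 \<le> excess (\<zeta> \<omega>)"
    using excess_pos[of "\<zeta> \<omega>"] assms by auto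
qed (use assms in auto)

lemma potential_slope_nonneg: "0 \<le> u \<Longrightarrow> 0 \<le> potential_slope M m \<zeta> u"
  unfolding potential_slope_def by (intro integral_nonneg_AE AE_I2 kernel_nonneg)

lemma potential_nonneg: "0 \<le> u \<Longrightarrow> 0 \<le> potential M m \<zeta> u"
  unfolding potential_def
  by (intro integral_nonneg_AE AE_I2 mult_nonneg_nonneg kernel_nonneg less_imp_le[OF excess_pos])

lemma potential_antimono:
  assumes "integrable M \<zeta>" "0 < v" "v \<le> u"
  shows "potential M m \<zeta> u \<le> potential M m \<zeta> v"
proof -
  have "0 \<le> (u - v) * real m * potential_slope M (Suc m) \<zeta> u"
    using assms potential_slope_nonneg[of u "Suc m" \<zeta>] by simp
  moreover have "potential M m \<zeta> u \<le> potential M m \<zeta> v - (u - v) * real m * potential_slope M (Suc m) \<zeta> u"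
    using potential_tangent_bound[OF assms(1), of v "u - v" m] assms by simp
  ultimately show ?thesis by linarith
qed

lemma potential_lower_bound:
  assumes "integrable M \<zeta>" "0 \<le> u"
  shows "(1 / (1 + u)) ^ m \<le> potential M m \<zeta> u"
proof -
  have "(1 / (1 + u)) ^ m \<le> excess w * (excess w / (excess w + u)) ^ m" for w
  proof -
    have "1 / (1 + u) \<le> excess w / (excess w + u)"
      using excess_ge_1[of w] assms(2) mult_left_mono[of 1 "excess w" u] by (simp add: field_simps)
    then have "(1 / (1 + u)) ^ m \<le> (excess w / (excess w + u)) ^ m"
      using assms(2) by (intro power_mono) auto
    also have "\<dots> \<le> excess w * (excess w / (excess w + u)) ^ m"
      using mult_right_mono[OF excess_ge_1[of w] kernel_nonneg[OF assms(2), of w m]] by simp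
    finally show ?thesis .
  qed
  then have "(\<integral>\<omega>. (1 / (1 + u)) ^ m \<partial>M) \<le> potential M m \<zeta> u"
    unfolding potential_def using assms
    by (intro integral_mono integrable_potential_kernel) auto
  then show ?thesis by (simp add: prob_space)
qed

lemma prob_le_potential_slope:
  assumes [measurable]: "\<zeta> \<in> borel_measurable M" and "0 < u"
  shows "prob {\<omega>\<in>space M. \<zeta> \<omega> < - (u / 2)} \<le> 3 ^ m * potential_slope M m \<zeta> u"
proof -
  have pw: "of_bool (w < - (u / 2)) \<le> 3 ^ m * (excess w / (excess w + u)) ^ m" for w
  proof (cases "w < - (u / 2)")
    case True
    then have "u / 2 < excess w" by (auto simp: excess_def)
    then have "1 \<le> 3 * (excess w / (excess w + u))" using assms(2) excess_pos[of w] by (simp add: field_simps)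
    then have "1 \<le> (3 * (excess w / (excess w + u))) ^ m" by (rule one_le_power)
    then show ?thesis using True by (simp only: power_mult_distrib) simp
  next
    case False
    then show ?thesis using kernel_nonneg[of u w m] assms(2) by (simp del: power_divide)
  qed
  have "prob {\<omega>\<in>space M. \<zeta> \<omega> < - (u / 2)} = (\<integral>\<omega>. indicator {\<omega>\<in>space M. \<zeta> \<omega> < - (u / 2)} \<omega> \<partial>M)"
    by simp
  also have "\<dots> \<le> (\<integral>\<omega>. 3 ^ m * (excess (\<zeta> \<omega>) / (excess (\<zeta> \<omega>) + u)) ^ m \<partial>M)"
  proof (intro integral_mono integrable_mult_right integrable_slope_kernel)
    fix \<omega> assume "\<omega> \<in> space M"
    then show "indicator {\<omega> \<in> space M. \<zeta> \<omega> < - (u / 2)} \<omega> \<le> 3 ^ m * (excess (\<zeta> \<omega>) / (excess (\<zeta> \<omega>) + u)) ^ m"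
      using pw[of "\<zeta> \<omega>"] by (simp add: indicator_def)
  qed (use assms in \<open>auto simp: emeasure_eq_measure\<close>)
  also have "\<dots> = 3 ^ m * potential_slope M m \<zeta> u"
    unfolding potential_slope_def by (simp only: integral_mult_right_zero)
  finally show ?thesis .
qed

section \<open>The Lyapunov function\<close>

lemma borel_measurable_lyapunov [measurable]:
  assumes [measurable]: "\<zeta> \<in> borel_measurable M"
  shows "lyapunov M m \<zeta> C \<in> borel_measurable borel"
  unfolding lyapunov_def by measurable

lemma lyapunov_le_1: "lyapunov M m \<zeta> C u \<le> 1"
  by (simp add: lyapunov_def)

lemma lyapunov_nonneg: "C \<ge> 0 \<Longrightarrow> 0 \<le> lyapunov M m \<zeta> C u"
  using potential_nonneg[of u m \<zeta>] by (auto simp: lyapunov_def)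

text \<open>
A pointwise bound for one step of size \<open>s\<close> from level \<open>u\<close>. Steps between \<open>- A\<close> and \<open>A\<close> contribute
the linear term, because there the slope differs from its value at \<open>u\<close> by a factor in
\<open>[1 - \<theta>, 1 + \<theta>]\<close>; upward steps count only up to \<open>A\<close>. Downward steps beyond \<open>A\<close> but within
\<open>u / 2\<close> lose a factor \<open>2 ^ Suc m\<close> in the slope, which is harmless since such steps have small mean.
Steps below \<open>- (u / 2)\<close> are charged the maximal value 1.
\<close>
lemma lyapunov_step_bound:
  fixes A \<theta> C u s :: real
  assumes \<zeta>: "integrable M \<zeta>" and A: "A > 0" and u: "2 * A \<le> u" and C: "C > 0"
    and \<theta>: "\<theta> > 0" "\<And>v. v \<ge> u - A \<Longrightarrow> ((v + A) / v) ^ Suc m \<le> 1 + \<theta>"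
  shows "lyapunov M m \<zeta> C (u + s) \<le> C * potential M m \<zeta> u + of_bool (s < - (u / 2))
    + C * real m * potential_slope M (Suc m) \<zeta> u
      * (\<theta> * A - max (- A) (min A s) + 2 ^ Suc m * (max 0 (- s) * of_bool (s < - A)))"
proof -
  have [measurable]: "\<zeta> \<in> borel_measurable M" using \<zeta> by auto
  let ?H = "potential M m \<zeta>" and ?G = "potential_slope M (Suc m) \<zeta>"
  let ?R = "\<theta> * A - max (- A) (min A s) + 2 ^ Suc m * (max 0 (- s) * of_bool (s < - A))"
  have u0: "u > 0" "u - A > 0" "u \<ge> 0" using A u by auto
  have G0: "0 \<le> ?G u" using potential_slope_nonneg u0 by auto
  have Gleft: "?G (u - A) \<le> (1 + \<theta>) * ?G u"
  proof -
    have "?G (u - A) \<le> (u / (u - A)) ^ Suc m * ?G u"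
      using potential_slope_scaling_bound[of \<zeta> "u - A" u "Suc m"] A u0 by simp
    also have "\<dots> \<le> (1 + \<theta>) * ?G u"
      using \<theta>(2)[of "u - A"] G0 by (intro mult_right_mono) auto
    finally show ?thesis .
  qed
  have Gright: "(1 - \<theta>) * ?G u \<le> ?G (u + A)"
  proof -
    have G1: "0 \<le> ?G (u + A)" using potential_slope_nonneg u0 A by auto
    have "?G u \<le> ((u + A) / u) ^ Suc m * ?G (u + A)"
      using potential_slope_scaling_bound[of \<zeta> u "u + A" "Suc m"] A u0 by simp
    also have "\<dots> \<le> (1 + \<theta>) * ?G (u + A)"
      using \<theta>(2)[of u] A G1 by (intro mult_right_mono) auto
    finally have *: "?G u \<le> (1 + \<theta>) * ?G (u + A)" .
    show ?thesis
    proof (cases "\<theta> \<le> 1")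
      case True
      have "(1 - \<theta>) * ?G u \<le> (1 - \<theta>) * ((1 + \<theta>) * ?G (u + A))"
        using * True by (intro mult_left_mono) auto
      also have "\<dots> = ?G (u + A) - \<theta>\<^sup>2 * ?G (u + A)" by (simp add: algebra_simps power2_eq_square)
      also have "\<dots> \<le> ?G (u + A)" using G1 by simp
      finally show ?thesis .
    next
      case False
      then have "(1 - \<theta>) * ?G u \<le> 0" using G0 by (simp add: mult_nonpos_nonneg)
      then show ?thesis using G1 by linarith
    qed
  qed
  have Ghalf: "?G (u / 2) \<le> 2 ^ Suc m * ?G u"
    using potential_slope_scaling_bound[of \<zeta> "u / 2" u "Suc m"] u0 by simp
  show ?thesis
  proof (cases "s < - (u / 2)")
    case True
    then have "s < - A" using u by linarith
    then have "?R = \<theta> * A + A + 2 ^ Suc m * (- s)" using A by (auto simp: min_def max_def)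
    moreover have "0 \<le> \<theta> * A" using A \<theta> by simp
    moreover have "0 \<le> 2 ^ Suc m * (- s)"
      using \<open>s < - A\<close> A by (intro mult_nonneg_nonneg) auto
    ultimately have "0 \<le> ?R" using A by linarith
    then have "0 \<le> C * real m * ?G u * ?R" using C G0 by simp
    moreover have "0 \<le> C * ?H u" using C potential_nonneg u0 by auto
    ultimately show ?thesis using True lyapunov_le_1[of m \<zeta> C "u + s"] by simp
  next
    case False
    then have us: "u + s > 0" using u0 by linarith
    have main: "?H (u + s) \<le> ?H u + real m * (?G u * ?R)"
    proof -
      have tangent: "?H (u + t) \<le> ?H u + real m * (- t * ?G (u + t))" if "u + t > 0" for t
        using potential_tangent_bound[OF \<zeta> u0(1) that, of m] by (simp add: algebra_simps)
      have bd: "?H (u + s) \<le> ?H u + real m * r" if "?H (u + s) \<le> ?H u + real m * r'" "r' \<le> r" for r r'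
        using that mult_left_mono[OF that(2), of "real m"] by linarith
      have m1: "a * ?G u \<le> b * ?G u" if "a \<le> b" for a b
        using that G0 by (rule mult_right_mono)
      consider "A \<le> s" | "0 \<le> s" "s < A" | "- A \<le> s" "s < 0" | "s < - A" by linarith
      then show ?thesis
      proof cases
        case 1
        have "?H (u + s) \<le> ?H (u + A)" using 1 A u0 by (intro potential_antimono \<zeta>) auto
        also have "\<dots> \<le> ?H u + real m * (- A * ?G (u + A))" using A u0 by (intro tangent) auto
        finally show ?thesis
        proof (rule bd)
          have "A * ((1 - \<theta>) * ?G u) \<le> A * ?G (u + A)" using Gright A by (intro mult_left_mono) auto
          then show "- A * ?G (u + A) \<le> ?G u * ?R" using 1 A by (simp add: algebra_simps)
        qed
      next
        case 2
        show ?thesis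
        proof (rule bd[OF tangent[OF us]])
          have "s * ((1 - \<theta>) * ?G u) \<le> s * ?G (u + A)" using Gright 2 by (intro mult_left_mono) auto
          also have "\<dots> \<le> s * ?G (u + s)"
            using 2 u0 by (intro mult_left_mono potential_slope_antimono) auto
          finally have "s * ((1 - \<theta>) * ?G u) \<le> s * ?G (u + s)" .
          moreover have "(s * \<theta>) * ?G u \<le> (A * \<theta>) * ?G u"
            using 2 \<theta> by (intro m1 mult_right_mono) auto
          ultimately show "- s * ?G (u + s) \<le> ?G u * ?R" using 2 A by (simp add: algebra_simps)
        qed
      next
        case 3
        show ?thesis
        proof (rule bd[OF tangent[OF us]])
          have "- s * ?G (u + s) \<le> - s * ?G (u - A)"
            using 3 u0 by (intro mult_left_mono potential_slope_antimono) auto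
          also have "\<dots> \<le> - s * ((1 + \<theta>) * ?G u)" using Gleft 3 by (intro mult_left_mono) auto
          finally have "- s * ?G (u + s) \<le> - s * ((1 + \<theta>) * ?G u)" .
          moreover have "(- s * \<theta>) * ?G u \<le> (A * \<theta>) * ?G u"
            using 3 \<theta> by (intro m1 mult_right_mono) auto
          ultimately show "- s * ?G (u + s) \<le> ?G u * ?R" using 3 A by (simp add: algebra_simps)
        qed
      next
        case 4
        show ?thesis
        proof (rule bd[OF tangent[OF us]])
          have "- s * ?G (u + s) \<le> - s * ?G (u / 2)"
            using 4 False A u0 by (intro mult_left_mono potential_slope_antimono) auto
          also have "\<dots> \<le> - s * (2 ^ Suc m * ?G u)" using Ghalf 4 A by (intro mult_left_mono) auto
          also have "\<dots> = (2 ^ Suc m * (- s)) * ?G u" by simp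
          also have "\<dots> \<le> ?R * ?G u"
            using 4 A \<theta> by (intro m1) (auto simp: min_def max_def)
          finally show "- s * ?G (u + s) \<le> ?G u * ?R" by (simp only: mult.commute)
        qed
      qed
    qed
    have "lyapunov M m \<zeta> C (u + s) \<le> C * ?H (u + s)" using us by (simp add: lyapunov_def)
    also have "\<dots> \<le> C * (?H u + real m * (?G u * ?R))" using main C by (intro mult_left_mono) auto
    finally show ?thesis using False by (simp add: algebra_simps)
  qed
qed

text \<open>
Integrating the step bound, the truncated drift \<open>\<beta>\<close> pays for everything: a quarter of it for the
variation \<open>\<theta>\<close> of the slope, a quarter for the steps below \<open>- A\<close>, and the remaining half, for large
\<open>C\<close>, for the jumps below \<open>- (u / 2)\<close>, whose probability is a bounded multiple of the slope.
At levels \<open>u \<le> x1\<close> the constant \<open>C\<close> is large enough to make the function equal to 1.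
\<close>
lemma lyapunov_drift:
  assumes \<zeta>: "integrable M \<zeta>" and A: "A > 0" and m: "m \<ge> 1" and \<beta>: "\<beta> > 0"
    and clip: "\<beta> \<le> (\<integral>\<omega>. max (- A) (min A (\<zeta> \<omega>)) \<partial>M)"
    and tail: "(\<integral>\<omega>. max 0 (- \<zeta> \<omega>) * of_bool (\<zeta> \<omega> < - A) \<partial>M) \<le> \<kappa>"
    and \<kappa>: "2 ^ Suc m * \<kappa> \<le> \<beta> / 4"
    and \<theta>: "\<theta> > 0" "\<theta> * A \<le> \<beta> / 4" "\<And>v. v \<ge> b \<Longrightarrow> ((v + A) / v) ^ Suc m \<le> 1 + \<theta>"
    and x1: "2 * A \<le> x1" "b + A \<le> x1"
    and C: "(1 + x1) ^ m \<le> C" "2 * 3 ^ Suc m / \<beta> \<le> C"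
  shows "(\<integral>\<omega>. lyapunov M m \<zeta> C (u + \<zeta> \<omega>) \<partial>M) \<le> lyapunov M m \<zeta> C u"
proof -
  have [measurable]: "\<zeta> \<in> borel_measurable M" using \<zeta> by auto
  have C0: "C > 0" using C(1) x1 A by (smt (verit) zero_less_power)
  let ?H = "potential M m \<zeta>" and ?G = "potential_slope M (Suc m) \<zeta>"
  let ?h = "lyapunov M m \<zeta> C"
  have int_h: "integrable M (\<lambda>\<omega>. ?h (u + \<zeta> \<omega>))"
    using lyapunov_le_1 lyapunov_nonneg[OF less_imp_le[OF C0]]
    by (intro integrable_const_bound[where B = 1]) auto
  show ?thesis
  proof (cases "?h u = 1")
    case True
    have "(\<integral>\<omega>. ?h (u + \<zeta> \<omega>) \<partial>M) \<le> (\<integral>\<omega>. 1 \<partial>M)"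
      by (intro integral_mono int_h lyapunov_le_1) simp
    then show ?thesis using True by (simp add: prob_space)
  next
    case False
    then have u0: "u > 0" and hu: "?h u = C * ?H u" and less1: "C * ?H u < 1"
      by (auto simp: lyapunov_def min_def split: if_splits)
    have ux: "x1 < u"
    proof (rule ccontr)
      assume "\<not> x1 < u"
      then have "1 \<le> ((1 + x1) * (1 / (1 + u))) ^ m" using u0 by (intro one_le_power) simp
      also have "\<dots> = (1 + x1) ^ m * (1 / (1 + u)) ^ m" by (simp only: power_mult_distrib)
      also have "\<dots> \<le> C * ?H u"
        using potential_lower_bound[OF \<zeta>, of u m] C(1) u0 C0 by (intro mult_mono) auto
      finally show False using less1 by simp
    qed
    let ?c = "\<lambda>\<omega>. max (- A) (min A (\<zeta> \<omega>))" and ?t = "\<lambda>\<omega>. max 0 (- \<zeta> \<omega>) * of_bool (\<zeta> \<omega> < - A)"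
    have int_c: "integrable M ?c"
      using A by (intro integrable_const_bound[where B = A]) auto
    have int_t: "integrable M ?t"
      by (rule Bochner_Integration.integrable_bound[OF \<zeta>]) auto
    have int_i: "integrable M (\<lambda>\<omega>. of_bool (\<zeta> \<omega> < - (u / 2)) :: real)"
      by (intro integrable_const_bound[where B = 1]) auto
    have p: "(\<integral>\<omega>. of_bool (\<zeta> \<omega> < - (u / 2)) \<partial>M) \<le> 3 ^ Suc m * ?G u"
    proof -
      have "(\<integral>\<omega>. of_bool (\<zeta> \<omega> < - (u / 2)) \<partial>M) = (\<integral>\<omega>. indicator {\<omega>\<in>space M. \<zeta> \<omega> < - (u / 2)} \<omega> \<partial>M)"
        by (intro Bochner_Integration.integral_cong) (auto simp: indicator_def)
      also have "\<dots> = prob {\<omega>\<in>space M. \<zeta> \<omega> < - (u / 2)}" by simp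
      also have "\<dots> \<le> 3 ^ Suc m * ?G u" using u0 by (intro prob_le_potential_slope) auto
      finally show ?thesis .
    qed
    have G0: "0 \<le> ?G u" using potential_slope_nonneg u0 by auto
    define K where "K = C * real m * ?G u"
    have K0: "K \<ge> 0" using C0 G0 by (simp add: K_def)
    have "(\<integral>\<omega>. ?h (u + \<zeta> \<omega>) \<partial>M)
      \<le> (\<integral>\<omega>. C * ?H u + of_bool (\<zeta> \<omega> < - (u / 2)) + K * (\<theta> * A - ?c \<omega> + 2 ^ Suc m * ?t \<omega>) \<partial>M)"
      unfolding K_def
      by (intro integral_mono int_h lyapunov_step_bound \<zeta> A C0 \<theta> Bochner_Integration.integrable_add
          Bochner_Integration.integrable_diff integrable_mult_right int_c int_t int_i integrable_const)
        (use ux x1 in auto)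
    also have "\<dots> = C * ?H u + (\<integral>\<omega>. of_bool (\<zeta> \<omega> < - (u / 2)) \<partial>M)
        + K * (\<theta> * A - (\<integral>\<omega>. ?c \<omega> \<partial>M) + 2 ^ Suc m * (\<integral>\<omega>. ?t \<omega> \<partial>M))"
      using int_c int_t int_i by (simp add: prob_space)
    also have "\<dots> \<le> C * ?H u + 3 ^ Suc m * ?G u + K * (- (\<beta> / 2))"
    proof (intro add_mono order_refl p mult_left_mono K0)
      have "2 ^ Suc m * (\<integral>\<omega>. ?t \<omega> \<partial>M) \<le> 2 ^ Suc m * \<kappa>" using tail by (intro mult_left_mono) auto
      then show "\<theta> * A - (\<integral>\<omega>. ?c \<omega> \<partial>M) + 2 ^ Suc m * (\<integral>\<omega>. ?t \<omega> \<partial>M) \<le> - (\<beta> / 2)"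
        using clip \<kappa> \<theta>(2) by linarith
    qed
    also have "\<dots> \<le> C * ?H u"
    proof -
      have "3 ^ Suc m * ?G u \<le> (C * \<beta> / 2) * ?G u"
        using C(2) \<beta> G0 by (intro mult_right_mono) (auto simp: field_simps)
      also have "\<dots> \<le> (C * \<beta> / 2) * (real m * ?G u)"
        using m C0 \<beta> G0 by (intro mult_left_mono) (auto simp: mult_le_cancel_right1)
      finally show ?thesis by (simp add: K_def algebra_simps)
    qed
    finally show ?thesis using hu by simp
  qed
qed

text \<open>
Raising \<open>\<zeta>\<close> can only increase the truncated drift and decrease the mean of the steps below \<open>- A\<close>,
and \<open>C\<close> depends on the step distribution only through bounds for these two numbers. Hence one constant
serves all \<open>\<zeta>' \<ge> \<zeta>\<close>, although the potential is that of \<open>\<zeta>'\<close>.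
\<close>
lemma ex_uniform_lyapunov_drift:
  assumes \<zeta>: "integrable M \<zeta>" and pos: "0 < (\<integral>\<omega>. \<zeta> \<omega> \<partial>M)" and m: "m \<ge> 1"
  shows "\<exists>C>0. \<forall>\<zeta>' u. integrable M \<zeta>' \<longrightarrow> (\<forall>\<omega>. \<zeta> \<omega> \<le> \<zeta>' \<omega>)
    \<longrightarrow> (\<integral>\<omega>. lyapunov M m \<zeta>' C (u + \<zeta>' \<omega>) \<partial>M) \<le> lyapunov M m \<zeta>' C u"
proof -
  have [measurable]: "\<zeta> \<in> borel_measurable M" using \<zeta> by auto
  define \<beta> where "\<beta> = (\<integral>\<omega>. \<zeta> \<omega> \<partial>M) / 2"
  define \<kappa> where "\<kappa> = \<beta> / (4 * 2 ^ Suc m)"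
  have \<beta>: "\<beta> > 0" and \<kappa>: "\<kappa> > 0" using pos by (auto simp: \<beta>_def \<kappa>_def)
  have "((\<lambda>A. \<integral>\<omega>. max (- A) (min A (\<zeta> \<omega>)) \<partial>M) \<longlongrightarrow> (\<integral>\<omega>. \<zeta> \<omega> \<partial>M)) at_top"
  proof (rule integral_dominated_convergence_at_top[where w = "\<lambda>\<omega>. \<bar>\<zeta> \<omega>\<bar>"])
    show "AE \<omega> in M. ((\<lambda>A. max (- A) (min A (\<zeta> \<omega>))) \<longlongrightarrow> \<zeta> \<omega>) at_top"
    proof (intro AE_I2 tendsto_eventually)
      fix \<omega> show "\<forall>\<^sub>F A in at_top. max (- A) (min A (\<zeta> \<omega>)) = \<zeta> \<omega>"
        using eventually_ge_at_top[of "\<bar>\<zeta> \<omega>\<bar>"] by eventually_elim auto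
    qed
    show "\<forall>\<^sub>F A in at_top. AE \<omega> in M. norm (max (- A) (min A (\<zeta> \<omega>))) \<le> \<bar>\<zeta> \<omega>\<bar>"
      using eventually_ge_at_top[of 0] by eventually_elim (auto intro!: AE_I2)
  qed (use \<zeta> in auto)
  then have ev1: "\<forall>\<^sub>F A in at_top. \<beta> < (\<integral>\<omega>. max (- A) (min A (\<zeta> \<omega>)) \<partial>M)"
    using pos by (intro order_tendstoD) (auto simp: \<beta>_def)
  have "((\<lambda>A. \<integral>\<omega>. max 0 (- \<zeta> \<omega>) * of_bool (\<zeta> \<omega> < - A) \<partial>M) \<longlongrightarrow> (\<integral>\<omega>. 0 \<partial>M)) at_top"
  proof (rule integral_dominated_convergence_at_top[where w = "\<lambda>\<omega>. \<bar>\<zeta> \<omega>\<bar>"])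
    show "AE \<omega> in M. ((\<lambda>A. max 0 (- \<zeta> \<omega>) * of_bool (\<zeta> \<omega> < - A)) \<longlongrightarrow> 0) at_top"
    proof (intro AE_I2 tendsto_eventually)
      fix \<omega> show "\<forall>\<^sub>F A in at_top. max 0 (- \<zeta> \<omega>) * of_bool (\<zeta> \<omega> < - A) = 0"
        using eventually_ge_at_top[of "- \<zeta> \<omega>"] by eventually_elim auto
    qed
  qed (use \<zeta> in \<open>auto intro!: AE_I2 always_eventually\<close>)
  then have ev2: "\<forall>\<^sub>F A in at_top. (\<integral>\<omega>. max 0 (- \<zeta> \<omega>) * of_bool (\<zeta> \<omega> < - A) \<partial>M) < \<kappa>"
    using \<kappa> by (intro order_tendstoD(2)) auto
  from eventually_happens'[OF _ eventually_conj[OF ev1 eventually_conj[OF ev2 eventually_gt_at_top[of 0]]]]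
  obtain A where A: "A > 0" "\<beta> < (\<integral>\<omega>. max (- A) (min A (\<zeta> \<omega>)) \<partial>M)"
    "(\<integral>\<omega>. max 0 (- \<zeta> \<omega>) * of_bool (\<zeta> \<omega> < - A) \<partial>M) < \<kappa>" by auto
  define \<theta> where "\<theta> = \<beta> / (4 * A)"
  have \<theta>: "\<theta> > 0" "\<theta> * A \<le> \<beta> / 4" using \<beta> A by (auto simp: \<theta>_def)
  have "((\<lambda>v. ((v + A) / v) ^ Suc m) \<longlongrightarrow> 1 ^ Suc m) at_top"
  proof (rule tendsto_power)
    show "((\<lambda>v. (v + A) / v) \<longlongrightarrow> 1) at_top" by real_asymp
  qed
  then have "\<forall>\<^sub>F v in at_top. ((v + A) / v) ^ Suc m < 1 + \<theta>"
    using \<theta> by (intro order_tendstoD(2)) auto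
  then obtain b where b: "\<And>v. v \<ge> b \<Longrightarrow> ((v + A) / v) ^ Suc m \<le> 1 + \<theta>"
    unfolding eventually_at_top_linorder by (meson less_imp_le)
  define x1 where "x1 = max (2 * A) (b + A)"
  define C where "C = max ((1 + x1) ^ m) (2 * 3 ^ Suc m / \<beta>)"
  have "C > 0" using \<beta> by (simp add: C_def less_max_iff_disj)
  moreover have "(\<integral>\<omega>. lyapunov M m \<zeta>' C (u + \<zeta>' \<omega>) \<partial>M) \<le> lyapunov M m \<zeta>' C u"
    if \<zeta>': "integrable M \<zeta>'" "\<forall>\<omega>. \<zeta> \<omega> \<le> \<zeta>' \<omega>" for \<zeta>' u
  proof (rule lyapunov_drift[OF \<zeta>'(1) A(1) m \<beta> _ _ _ \<theta> b, where \<kappa> = \<kappa> and ?x1.0 = x1])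
    have [measurable]: "\<zeta>' \<in> borel_measurable M" using \<zeta>' by auto
    have "(\<integral>\<omega>. max (- A) (min A (\<zeta> \<omega>)) \<partial>M) \<le> (\<integral>\<omega>. max (- A) (min A (\<zeta>' \<omega>)) \<partial>M)"
    proof (rule integral_mono)
      fix \<omega> show "max (- A) (min A (\<zeta> \<omega>)) \<le> max (- A) (min A (\<zeta>' \<omega>))"
        using \<zeta>'(2)[rule_format, of \<omega>] by auto
    qed (use A(1) in \<open>auto intro!: integrable_const_bound[where B = A]\<close>)
    then show "\<beta> \<le> (\<integral>\<omega>. max (- A) (min A (\<zeta>' \<omega>)) \<partial>M)" using A by linarith
    have "(\<integral>\<omega>. max 0 (- \<zeta>' \<omega>) * of_bool (\<zeta>' \<omega> < - A) \<partial>M) \<le> (\<integral>\<omega>. max 0 (- \<zeta> \<omega>) * of_bool (\<zeta> \<omega> < - A) \<partial>M)"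
    proof (rule integral_mono)
      fix \<omega> show "max 0 (- \<zeta>' \<omega>) * of_bool (\<zeta>' \<omega> < - A) \<le> max 0 (- \<zeta> \<omega>) * of_bool (\<zeta> \<omega> < - A)"
        using \<zeta>'(2)[rule_format, of \<omega>] A by auto
    next
      show "integrable M (\<lambda>\<omega>. max 0 (- \<zeta>' \<omega>) * of_bool (\<zeta>' \<omega> < - A))"
        by (rule Bochner_Integration.integrable_bound[OF \<zeta>'(1)]) auto
      show "integrable M (\<lambda>\<omega>. max 0 (- \<zeta> \<omega>) * of_bool (\<zeta> \<omega> < - A))"
        by (rule Bochner_Integration.integrable_bound[OF \<zeta>]) auto
    qed
    then show "(\<integral>\<omega>. max 0 (- \<zeta>' \<omega>) * of_bool (\<zeta>' \<omega> < - A) \<partial>M) \<le> \<kappa>" using A by linarith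
    show "2 ^ Suc m * \<kappa> \<le> \<beta> / 4" by (simp add: \<kappa>_def)
  qed (auto simp: x1_def C_def)
  ultimately show ?thesis by blast
qed

end

section \<open>Ruin probabilities\<close>

definition ruin_by :: "nat \<Rightarrow> real \<Rightarrow> (nat \<Rightarrow> real) \<Rightarrow> bool" where
  "ruin_by n u f \<longleftrightarrow> (\<exists>k\<le>n. u + (\<Sum>i=1..k. f i) \<le> 0)"

definition stopped_value :: "(real \<Rightarrow> real) \<Rightarrow> real \<Rightarrow> nat \<Rightarrow> (nat \<Rightarrow> real) \<Rightarrow> real" where
  "stopped_value h u n f = (if ruin_by n u f then 1 else h (u + (\<Sum>i=1..n. f i)))"

lemma measurable_partial_sum [measurable]:
  "(k::nat) \<le> n \<Longrightarrow> (\<lambda>f. \<Sum>i=1..k. f i :: real) \<in> borel_measurable (PiM {1..n} (\<lambda>_. borel))"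
  by (intro borel_measurable_sum measurable_component_singleton) auto

lemma measurable_ruin_by [measurable]:
  "Measurable.pred (PiM {1..n} (\<lambda>_. borel)) (ruin_by n u)"
proof -
  have "ruin_by n u = (\<lambda>f. \<exists>k\<in>{..n}. u + (\<Sum>i=1..k. f i) \<le> 0)"
    by (auto simp: ruin_by_def fun_eq_iff)
  moreover have "Measurable.pred (PiM {1..n} (\<lambda>_. borel)) (\<lambda>f. \<exists>k\<in>{..n}. u + (\<Sum>i=1..k. f i) \<le> (0::real))"
    by (intro pred_intros_finite) auto
  ultimately show ?thesis by simp
qed

lemma measurable_stopped_value [measurable]:
  assumes [measurable]: "h \<in> borel_measurable borel"
  shows "stopped_value h u n \<in> borel_measurable (PiM {1..n} (\<lambda>_. borel))"
  unfolding stopped_value_def by measurable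

lemma ruin_by_Suc_upd:
  "ruin_by (Suc n) u (f(Suc n := y)) \<longleftrightarrow> ruin_by n u f \<or> u + (\<Sum>i=1..n. f i) + y \<le> 0"
proof -
  have "(\<Sum>i=1..k. (f(Suc n := y)) i) = (\<Sum>i=1..k. f i)" if "k \<le> n" for k
    using that by (intro sum.cong) auto
  moreover have "(\<Sum>i=1..Suc n. (f(Suc n := y)) i) = (\<Sum>i=1..n. f i) + y"
    using calculation[of n] by simp
  ultimately show ?thesis
    unfolding ruin_by_def by (auto simp: le_Suc_eq add.assoc)
qed

text \<open>
The supermartingale property of \<open>h\<close> along the walk stopped at ruin, with the law of the first \<open>n\<close>
steps as a product measure: integrating out the last coordinate applies the drift hypothesis.
At the step that causes ruin the stopped value 1 agrees with \<open>h\<close>, because \<open>h = 1\<close> on \<open>{..0}\<close>.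
\<close>
lemma stopped_value_integral_le:
  fixes D :: "real measure"
  assumes D: "prob_space D" "sets D = sets borel"
    and [measurable]: "h \<in> borel_measurable borel"
    and one: "\<And>v. v \<le> 0 \<Longrightarrow> h v = 1"
    and drift: "\<And>v. (\<integral>\<^sup>+y. ennreal (h (v + y)) \<partial>D) \<le> ennreal (h v)"
  shows "(\<integral>\<^sup>+f. ennreal (stopped_value h u n f) \<partial>PiM {1..n} (\<lambda>_. D)) \<le> ennreal (h u)"
proof (induction n)
  case 0
  have "stopped_value h u 0 = (\<lambda>_. h u)"
    using one by (auto simp: stopped_value_def ruin_by_def fun_eq_iff)
  then show ?case by (simp add: PiM_empty)
next
  case (Suc n)
  interpret D: prob_space D by fact
  interpret P: product_prob_space "\<lambda>_. D" "{1..n}" by unfold_locales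
  have eq: "sets (PiM I (\<lambda>_. D)) = sets (PiM I (\<lambda>_. borel))" for I :: "nat set"
    by (intro sets_PiM_cong) (auto simp: D)
  have meas: "(\<lambda>f. ennreal (stopped_value h u (Suc n) f)) \<in> borel_measurable (PiM (insert (Suc n) {1..n}) (\<lambda>_. D))"
  proof -
    have "(\<lambda>f. ennreal (stopped_value h u (Suc n) f)) \<in> borel_measurable (PiM {1..Suc n} (\<lambda>_. borel))"
      by measurable
    moreover have "insert (Suc n) {1..n} = {1..Suc n}" by auto
    ultimately show ?thesis by (simp only: measurable_cong_sets[OF eq refl])
  qed
  have "(\<integral>\<^sup>+f. ennreal (stopped_value h u (Suc n) f) \<partial>PiM {1..Suc n} (\<lambda>_. D))
    = (\<integral>\<^sup>+f. ennreal (stopped_value h u (Suc n) f) \<partial>PiM (insert (Suc n) {1..n}) (\<lambda>_. D))"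
    by (intro arg_cong2[where f = nn_integral] arg_cong2[where f = PiM]) auto
  also have "\<dots> = (\<integral>\<^sup>+f. (\<integral>\<^sup>+y. ennreal (stopped_value h u (Suc n) (f(Suc n := y))) \<partial>D) \<partial>PiM {1..n} (\<lambda>_. D))"
    by (intro P.product_nn_integral_insert meas) auto
  also have "\<dots> \<le> (\<integral>\<^sup>+f. ennreal (stopped_value h u n f) \<partial>PiM {1..n} (\<lambda>_. D))"
  proof (rule nn_integral_mono)
    fix f :: "nat \<Rightarrow> real"
    show "(\<integral>\<^sup>+y. ennreal (stopped_value h u (Suc n) (f(Suc n := y))) \<partial>D) \<le> ennreal (stopped_value h u n f)"
    proof (cases "ruin_by n u f")
      case True
      then show ?thesis
        by (simp add: stopped_value_def ruin_by_Suc_upd D.emeasure_space_1)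
    next
      case False
      have "stopped_value h u (Suc n) (f(Suc n := y)) = h ((u + (\<Sum>i=1..n. f i)) + y)" for y
      proof -
        have "(\<Sum>i=1..n. (f(Suc n := y)) i) = (\<Sum>i=1..n. f i)" by (intro sum.cong) auto
        then show ?thesis
          using False one[of "(u + (\<Sum>i=1..n. f i)) + y"]
          by (auto simp: stopped_value_def ruin_by_Suc_upd add.assoc)
      qed
      then show ?thesis using drift[of "u + (\<Sum>i=1..n. f i)"] False by (simp add: stopped_value_def)
    qed
  qed
  also note Suc.IH
  finally show ?case .
qed

context prob_space
begin

lemma prob_ruin_by_le:
  fixes \<eta> :: "nat \<Rightarrow> 'a \<Rightarrow> real"
  assumes indep: "indep_vars (\<lambda>_. borel) \<eta> {1..}"
    and ident: "\<And>i. i \<ge> 1 \<Longrightarrow> distr M borel (\<eta> i) = distr M borel \<zeta>"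
    and \<zeta> [measurable]: "\<zeta> \<in> borel_measurable M"
    and h [measurable]: "h \<in> borel_measurable borel"
    and one: "\<And>v. v \<le> 0 \<Longrightarrow> h v = 1" and bounds: "\<And>v. 0 \<le> h v" "\<And>v. h v \<le> 1"
    and drift: "\<And>v. (\<integral>\<omega>. h (v + \<zeta> \<omega>) \<partial>M) \<le> h v"
  shows "prob {\<omega>\<in>space M. ruin_by n u (\<lambda>i. \<eta> i \<omega>)} \<le> h u"
proof -
  define D where "D = distr M borel \<zeta>"
  have D: "prob_space D" "sets D = sets borel" by (auto simp: D_def prob_space_distr)
  have rv [measurable]: "\<eta> i \<in> borel_measurable M" if "i \<in> {1..Suc n}" for i
    using indep that by (auto simp: indep_vars_def2)
  have drift': "(\<integral>\<^sup>+y. ennreal (h (v + y)) \<partial>D) \<le> ennreal (h v)" for v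
  proof -
    have "(\<integral>\<^sup>+y. ennreal (h (v + y)) \<partial>D) = (\<integral>\<^sup>+\<omega>. ennreal (h (v + \<zeta> \<omega>)) \<partial>M)"
      unfolding D_def by (simp add: nn_integral_distr)
    also have "\<dots> = ennreal (\<integral>\<omega>. h (v + \<zeta> \<omega>) \<partial>M)"
      using bounds by (intro nn_integral_eq_integral integrable_const_bound[where B = 1]) auto
    also have "\<dots> \<le> ennreal (h v)" using drift by (rule ennreal_leI)
    finally show ?thesis .
  qed
  (* One step more than needed, so that the path is a nonempty family also for n = 0. *)
  define N where "N = Suc n"
  define path where "path \<omega> = (\<lambda>i\<in>{1..N}. \<eta> i \<omega>)" for \<omega>
  have path [measurable]: "path \<in> measurable M (PiM {1..N} (\<lambda>_. borel))"
    unfolding path_def N_def by measurable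
  have "distr M (PiM {1..N} (\<lambda>_. borel)) path = PiM {1..N} (\<lambda>i. distr M borel (\<eta> i))"
  proof -
    have "indep_vars (\<lambda>_. borel) \<eta> {1..N}" by (rule indep_vars_subset[OF indep]) auto
    moreover have "{1..N} \<noteq> {}" by (simp add: N_def)
    ultimately show ?thesis
      unfolding path_def using rv by (subst (asm) indep_vars_iff_distr_eq_PiM') (auto simp: N_def)
  qed
  also have "\<dots> = PiM {1..N} (\<lambda>_. D)" unfolding D_def by (intro PiM_cong ident) auto
  finally have law: "distr M (PiM {1..N} (\<lambda>_. borel)) path = PiM {1..N} (\<lambda>_. D)" .
  have ruin: "ruin_by N u (path \<omega>) \<longleftrightarrow> ruin_by N u (\<lambda>i. \<eta> i \<omega>)" for \<omega>
  proof -
    have "(\<Sum>i=1..k. path \<omega> i) = (\<Sum>i=1..k. \<eta> i \<omega>)" if "k \<le> N" for k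
      using that by (intro sum.cong) (auto simp: path_def)
    then show ?thesis by (auto simp: ruin_by_def)
  qed
  have "ennreal (prob {\<omega>\<in>space M. ruin_by N u (path \<omega>)})
    = (\<integral>\<^sup>+\<omega>. indicator {\<omega>\<in>space M. ruin_by N u (path \<omega>)} \<omega> \<partial>M)"
    by (subst nn_integral_indicator) (auto simp: emeasure_eq_measure)
  also have "\<dots> \<le> (\<integral>\<^sup>+\<omega>. ennreal (stopped_value h u N (path \<omega>)) \<partial>M)"
    by (intro nn_integral_mono) (auto simp: indicator_def stopped_value_def bounds)
  also have "\<dots> = (\<integral>\<^sup>+f. ennreal (stopped_value h u N f) \<partial>PiM {1..N} (\<lambda>_. D))"
  proof -
    have "(\<lambda>f. ennreal (stopped_value h u N f)) \<in> borel_measurable (distr M (PiM {1..N} (\<lambda>_. borel)) path)"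
      by (subst measurable_distr_eq1) measurable
    from nn_integral_distr[OF path this] show ?thesis unfolding law by simp
  qed
  also have "\<dots> \<le> ennreal (h u)" by (intro stopped_value_integral_le D h one drift')
  finally have "prob {\<omega>\<in>space M. ruin_by N u (path \<omega>)} \<le> h u" using bounds by simp
  moreover have "prob {\<omega>\<in>space M. ruin_by n u (\<lambda>i. \<eta> i \<omega>)} \<le> prob {\<omega>\<in>space M. ruin_by N u (path \<omega>)}"
  proof (intro finite_measure_mono subsetI)
    show "\<omega> \<in> {\<omega>\<in>space M. ruin_by N u (path \<omega>)}"
      if "\<omega> \<in> {\<omega>\<in>space M. ruin_by n u (\<lambda>i. \<eta> i \<omega>)}" for \<omega>
      using that unfolding ruin by (auto simp: ruin_by_def N_def dest: le_SucI)
  qed measurable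
  ultimately show ?thesis by linarith
qed

lemma ex_uniform_ruin_bound:
  assumes \<zeta>: "integrable M \<zeta>" and pos: "0 < (\<integral>\<omega>. \<zeta> \<omega> \<partial>M)" and m: "m \<ge> 1"
  obtains C where "C > 0" "\<And>\<zeta>' \<eta> n u. integrable M \<zeta>' \<Longrightarrow> (\<And>\<omega>. \<zeta> \<omega> \<le> \<zeta>' \<omega>)
    \<Longrightarrow> indep_vars (\<lambda>_. borel) \<eta> {1..}
    \<Longrightarrow> (\<And>i. i \<ge> 1 \<Longrightarrow> distr M borel (\<eta> i) = distr M borel \<zeta>') \<Longrightarrow> 0 < u
    \<Longrightarrow> prob {\<omega>\<in>space M. ruin_by n u (\<lambda>i. \<eta> i \<omega>)} \<le> C * potential M m \<zeta>' u"
proof -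
  obtain C where C: "C > 0" and drift: "\<And>\<zeta>' u. integrable M \<zeta>' \<Longrightarrow> (\<forall>\<omega>. \<zeta> \<omega> \<le> \<zeta>' \<omega>)
    \<Longrightarrow> (\<integral>\<omega>. lyapunov M m \<zeta>' C (u + \<zeta>' \<omega>) \<partial>M) \<le> lyapunov M m \<zeta>' C u"
    using ex_uniform_lyapunov_drift[OF assms] by blast
  have "prob {\<omega>\<in>space M. ruin_by n u (\<lambda>i. \<eta> i \<omega>)} \<le> C * potential M m \<zeta>' u"
    if *: "integrable M \<zeta>'" "\<And>\<omega>. \<zeta> \<omega> \<le> \<zeta>' \<omega>" "indep_vars (\<lambda>_. borel) \<eta> {1..}"
      "\<And>i. i \<ge> 1 \<Longrightarrow> distr M borel (\<eta> i) = distr M borel \<zeta>'" "0 < u" for \<zeta>' \<eta> n u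
  proof -
    have [measurable]: "\<zeta>' \<in> borel_measurable M" using * by auto
    have "prob {\<omega>\<in>space M. ruin_by n u (\<lambda>i. \<eta> i \<omega>)} \<le> lyapunov M m \<zeta>' C u"
    proof (rule prob_ruin_by_le[OF *(3)])
      show "(\<integral>\<omega>. lyapunov M m \<zeta>' C (v + \<zeta>' \<omega>) \<partial>M) \<le> lyapunov M m \<zeta>' C v" for v
        by (rule drift) (use * in auto)
      show "lyapunov M m \<zeta>' C v = 1" if "v \<le> 0" for v using that by (simp add: lyapunov_def)
    qed (use * C in \<open>auto intro: lyapunov_nonneg lyapunov_le_1\<close>)
    also have "\<dots> \<le> C * potential M m \<zeta>' u" using *(5) by (simp add: lyapunov_def)
    finally show ?thesis .
  qed
  then show ?thesis using C that by blast
qed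

end

section \<open>Decay of the potential relative to a heavy tail\<close>

text \<open>
Relative to \<open>p\<close> the recursion reads \<open>\<rho> x \<le> o(1) + \<rho> (x / 2) / 2\<close> with \<open>\<rho> = R / p\<close>. Each halving
leading back to a fixed interval, on which \<open>\<rho>\<close> is bounded, contributes a factor 1/2.
\<close>
lemma smallo_of_halving_recursion:
  fixes R J p :: "real \<Rightarrow> real"
  assumes p: "\<And>x. p x > 0" "antimono p" and x0: "x0 > 0"
    and R: "\<And>x. x \<ge> x0 \<Longrightarrow> 0 \<le> R x" "\<And>x. x \<ge> x0 \<Longrightarrow> R x \<le> B * x" and "B \<ge> 0"
    and rec: "\<And>x. x \<ge> x0 \<Longrightarrow> R x \<le> J x + q * R (x / 2)"
    and J: "J \<in> o[at_top](p)" and q: "q \<ge> 0"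
    and dom: "\<forall>\<^sub>F x in at_top. q * p (x / 2) \<le> p x / 2"
  shows "R \<in> o[at_top](p)"
proof (rule landau_o.smallI)
  fix c :: real assume c: "c > 0"
  have "\<forall>\<^sub>F x in at_top. norm (J x) \<le> c / 4 * norm (p x)"
    using landau_o.smallD[OF J, of "c / 4"] c by simp
  with dom have "\<forall>\<^sub>F x in at_top. norm (J x) \<le> c / 4 * norm (p x) \<and> q * p (x / 2) \<le> p x / 2 \<and> x \<ge> x0"
    using eventually_ge_at_top[of x0] by eventually_elim auto
  then obtain x1 where x1: "\<And>x. x \<ge> x1 \<Longrightarrow> norm (J x) \<le> c / 4 * norm (p x) \<and> q * p (x / 2) \<le> p x / 2 \<and> x \<ge> x0"
    unfolding eventually_at_top_linorder by auto
  have x1_pos: "x1 > 0" "x1 \<ge> x0" using x1[of x1] x0 by auto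
  define D where "D = B * (2 * x1) / p (2 * x1)"
  have D: "D \<ge> 0" using \<open>B \<ge> 0\<close> x1_pos p(1)[of "2 * x1"] by (simp add: D_def)
  (* D bounds R / p between x1 and 2 * x1. The term D * (2 * x1) / x stands for D / 2 ^ k, but unlike
  that one it does not depend on how x is placed in a dyadic scale. *)
  have bound: "R x \<le> (c / 2 + D * (2 * x1) / x) * p x" if "x1 \<le> x" "x \<le> 2 ^ k * (2 * x1)" for k x
    using that
  proof (induction k arbitrary: x)
    case 0
    have px: "p (2 * x1) \<le> p x" using 0 p(2) by (auto simp: antimono_def)
    have "R x \<le> B * (2 * x1)"
    proof -
      have "B * x \<le> B * (2 * x1)" using 0 \<open>B \<ge> 0\<close> by (intro mult_left_mono) auto
      then show ?thesis using R(2)[of x] 0 x1_pos by linarith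
    qed
    also have "\<dots> = D * p (2 * x1)" using p(1)[of "2 * x1"] by (simp add: D_def)
    also have "\<dots> \<le> D * p x" using px D by (rule mult_left_mono)
    also have "\<dots> \<le> (c / 2 + D * (2 * x1) / x) * p x"
    proof (rule mult_right_mono)
      have "D * 1 \<le> D * ((2 * x1) / x)" using 0 x1_pos D by (intro mult_left_mono) auto
      then show "D \<le> c / 2 + D * (2 * x1) / x" using c by simp
    qed (use p(1)[of x] in simp)
    finally show ?case .
  next
    case (Suc k)
    show ?case
    proof (cases "x \<le> 2 * x1")
      case True
      have "2 * x1 \<le> 2 ^ k * (2 * x1)" using x1_pos by simp
      then show ?thesis using Suc.IH[of x] Suc.prems True by auto
    next
      case False
      have x: "x \<ge> x0" "x > 0" using Suc.prems x1_pos by auto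
      have ih: "R (x / 2) \<le> (c / 2 + D * (2 * x1) / (x / 2)) * p (x / 2)"
        using False Suc.prems by (intro Suc.IH) auto
      have coef: "0 \<le> c / 2 + D * (2 * x1) / (x / 2)" using c D x x1_pos by simp
      have "R x \<le> J x + q * R (x / 2)" using rec x by simp
      also have "q * R (x / 2) \<le> q * ((c / 2 + D * (2 * x1) / (x / 2)) * p (x / 2))"
        using ih q by (rule mult_left_mono)
      also have "\<dots> = (c / 2 + D * (2 * x1) / (x / 2)) * (q * p (x / 2))" by simp
      also have "\<dots> \<le> (c / 2 + D * (2 * x1) / (x / 2)) * (p x / 2)"
        using x1[OF Suc.prems(1)] coef by (intro mult_left_mono) auto
      also have "J x \<le> c / 4 * p x"
        using x1[OF Suc.prems(1)] p(1)[of x] abs_ge_self[of "J x"] by (simp add: abs_of_pos)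
      finally show ?thesis using x by (simp add: field_simps)
    qed
  qed
  have "((\<lambda>x. D * (2 * x1) / x) \<longlongrightarrow> 0) at_top" by real_asymp
  then have "\<forall>\<^sub>F x in at_top. D * (2 * x1) / x < c / 2"
    using c by (intro order_tendstoD(2)) auto
  then show "\<forall>\<^sub>F x in at_top. norm (R x) \<le> c * norm (p x)"
    using eventually_ge_at_top[of x1]
  proof eventually_elim
    case (elim x)
    obtain k where "x / (2 * x1) < 2 ^ k" using real_arch_pow[of 2 "x / (2 * x1)"] by auto
    then have "x \<le> 2 ^ k * (2 * x1)" using x1_pos by (simp add: field_simps)
    then have "R x \<le> (c / 2 + D * (2 * x1) / x) * p x" using elim by (intro bound) auto
    also have "\<dots> \<le> c * p x" using elim p(1)[of x] by (intro mult_right_mono) auto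
    finally show ?case using R(1)[of x] elim x1_pos p(1)[of x] by simp
  qed
qed

text \<open>
For decreasing positive \<open>p\<close> this is dominated variation, the only consequence of intermediate
regular variation that the estimates for the walk use.
\<close>
definition dilation_bounded :: "(real \<Rightarrow> real) \<Rightarrow> bool" where
  "dilation_bounded p \<longleftrightarrow> (\<forall>c>0. \<exists>K>0. \<forall>\<^sub>F x in at_top. p (c * x) \<le> K * p x)"

lemma dilation_boundedI:
  fixes p :: "real \<Rightarrow> real"
  assumes p: "antimono p" and r: "0 < r" "r < 1" and ev: "\<forall>\<^sub>F x in at_top. p (r * x) \<le> 2 * p x"
  shows "dilation_bounded p"
  unfolding dilation_bounded_def
proof (intro allI impI)
  fix c :: real assume "c > 0"
  have iter: "\<forall>\<^sub>F x in at_top. p (r ^ n * x) \<le> 2 ^ n * p x" for n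
  proof (induction n)
    case (Suc n)
    have "filterlim (\<lambda>x. r ^ n * x) at_top at_top"
      using r by (intro filterlim_tendsto_pos_mult_at_top[OF tendsto_const]) (auto simp: filterlim_ident)
    with ev have "\<forall>\<^sub>F x in at_top. p (r * (r ^ n * x)) \<le> 2 * p (r ^ n * x)"
      by (rule eventually_compose_filterlim)
    with Suc show ?case by eventually_elim (simp add: mult.assoc)
  qed simp
  obtain n where n: "r ^ n < c" using real_arch_pow_inv[OF \<open>c > 0\<close> r(2)] by auto
  have "\<forall>\<^sub>F x in at_top. p (c * x) \<le> 2 ^ n * p x"
    using iter[of n] eventually_ge_at_top[of 0]
  proof eventually_elim
    case (elim x)
    have "p (c * x) \<le> p (r ^ n * x)" using n elim by (intro antimonoD[OF p] mult_right_mono) auto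
    then show ?case using elim by linarith
  qed
  then show "\<exists>K>0. \<forall>\<^sub>F x in at_top. p (c * x) \<le> K * p x" by (intro exI[of _ "2 ^ n"]) auto
qed

lemma smallo_dilate:
  assumes p: "\<And>x. p x > (0::real)" "dilation_bounded p" and f: "f \<in> o[at_top](p)" and "c > 0"
  shows "(\<lambda>x. f (c * x) :: real) \<in> o[at_top](p)"
proof -
  have "filterlim (\<lambda>x::real. c * x) at_top at_top"
    using \<open>c > 0\<close> by (intro filterlim_tendsto_pos_mult_at_top[OF tendsto_const]) (auto simp: filterlim_ident)
  with f have "(\<lambda>x. f (c * x)) \<in> o[at_top](\<lambda>x. p (c * x))" by (rule landau_o.small.compose)
  also obtain K where "\<forall>\<^sub>F x in at_top. p (c * x) \<le> K * p x"
    using p(2) \<open>c > 0\<close> by (auto simp: dilation_bounded_def)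
  then have "(\<lambda>x. p (c * x)) \<in> O[at_top](p)"
    using p(1) by (intro bigoI[of _ K]) (auto simp: less_imp_le)
  finally show ?thesis .
qed

text \<open>
The leading factor 2 serves the function \<open>x * potential_slope M m \<zeta> x\<close>, whose prefactor doubles
from \<open>x / 2\<close> to \<open>x\<close>.
\<close>
lemma ex_exponent:
  assumes p: "\<And>x. p x > (0::real)" "dilation_bounded p"
  shows "\<exists>m\<ge>1. \<forall>\<^sub>F x in at_top. 2 * (2 / 3) ^ m * p (x / 2) \<le> p x / 2"
proof -
  obtain K where K: "K > 0" "\<forall>\<^sub>F x in at_top. p (1 / 2 * x) \<le> K * p x"
    using p(2) unfolding dilation_bounded_def by (metis half_gt_zero_iff zero_less_one)
  obtain n where n: "(2 / 3) ^ n < 1 / (4 * K)"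
    using real_arch_pow_inv[of "1 / (4 * K)" "2 / 3"] K by auto
  have "(2 / 3 :: real) ^ Suc n \<le> (2 / 3) ^ n" by (intro power_decreasing) auto
  with n have "(2 / 3) ^ Suc n \<le> 1 / (4 * K)" by linarith
  then have s: "2 * (2 / 3) ^ Suc n * K \<le> 1 / 2" using K(1) by (simp add: field_simps)
  have "\<forall>\<^sub>F x in at_top. 2 * (2 / 3) ^ Suc n * p (x / 2) \<le> p x / 2"
    using K(2)
  proof eventually_elim
    case (elim x)
    have "2 * (2 / 3) ^ Suc n * p (x / 2) \<le> 2 * (2 / 3) ^ Suc n * (K * p x)"
      using elim by (intro mult_left_mono) auto
    also have "\<dots> = (2 * (2 / 3) ^ Suc n * K) * p x" by simp
    also have "\<dots> \<le> 1 / 2 * p x" using s p(1)[of x] by (intro mult_right_mono) auto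
    finally show ?case by simp
  qed
  then show ?thesis by (intro exI[of _ "Suc n"]) auto
qed

context prob_space
begin

lemma potential_slope_halving:
  assumes [measurable]: "\<zeta> \<in> borel_measurable M" and "u \<ge> 2"
  shows "potential_slope M m \<zeta> u \<le> prob {\<omega>\<in>space M. \<zeta> \<omega> < - (u / 2)} + (2 / 3) ^ m * potential_slope M m \<zeta> (u / 2)"
proof -
  have int_i: "integrable M (indicator {\<omega>\<in>space M. \<zeta> \<omega> < - (u / 2)} :: 'a \<Rightarrow> real)"
    by (auto simp: emeasure_eq_measure)
  have "potential_slope M m \<zeta> u \<le> (\<integral>\<omega>. indicator {\<omega>\<in>space M. \<zeta> \<omega> < - (u / 2)} \<omega>
      + (2 / 3) ^ m * (excess (\<zeta> \<omega>) / (excess (\<zeta> \<omega>) + u / 2)) ^ m \<partial>M)"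
    unfolding potential_slope_def
  proof (rule integral_mono)
    fix \<omega> assume "\<omega> \<in> space M"
    moreover have "excess (\<zeta> \<omega>) > u / 2 \<longleftrightarrow> \<zeta> \<omega> < - (u / 2)" using assms(2) by (auto simp: excess_def)
    ultimately show "(excess (\<zeta> \<omega>) / (excess (\<zeta> \<omega>) + u)) ^ m \<le> indicator {\<omega>\<in>space M. \<zeta> \<omega> < - (u / 2)} \<omega>
      + (2 / 3) ^ m * (excess (\<zeta> \<omega>) / (excess (\<zeta> \<omega>) + u / 2)) ^ m"
      using kernel_halving_bound[OF excess_pos, of u "\<zeta> \<omega>" m] assms(2) by (simp add: indicator_def of_bool_def)
  qed (use assms(2) in \<open>intro integrable_slope_kernel Bochner_Integration.integrable_add integrable_mult_right int_i assms; simp\<close>)+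
  also have "\<dots> = (\<integral>\<omega>. indicator {\<omega>\<in>space M. \<zeta> \<omega> < - (u / 2)} \<omega> \<partial>M)
      + (2 / 3) ^ m * potential_slope M m \<zeta> (u / 2)"
    unfolding potential_slope_def
    by (subst Bochner_Integration.integral_add[OF int_i])
      (use assms in \<open>auto intro!: integrable_mult_right integrable_slope_kernel simp del: power_divide\<close>)
  finally show ?thesis by simp
qed

lemma potential_halving:
  assumes \<zeta>: "integrable M \<zeta>" and "u \<ge> 2"
  shows "potential M m \<zeta> u \<le> (\<integral>\<omega>. - \<zeta> \<omega> * of_bool (\<zeta> \<omega> < - (u / 2)) \<partial>M)
    + (2 / 3) ^ m * potential M m \<zeta> (u / 2)"
proof -
  have [measurable]: "\<zeta> \<in> borel_measurable M" using \<zeta> by auto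
  have int_i: "integrable M (\<lambda>\<omega>. - \<zeta> \<omega> * of_bool (\<zeta> \<omega> < - (u / 2)))"
    by (rule Bochner_Integration.integrable_bound[OF \<zeta>]) auto
  have u2: "u / 2 \<ge> 0" "u \<ge> 0" using assms by auto
  note int_k = integrable_potential_kernel[OF \<zeta> u2(1), of m]
  have "potential M m \<zeta> u \<le> (\<integral>\<omega>. - \<zeta> \<omega> * of_bool (\<zeta> \<omega> < - (u / 2))
      + (2 / 3) ^ m * (excess (\<zeta> \<omega>) * (excess (\<zeta> \<omega>) / (excess (\<zeta> \<omega>) + u / 2)) ^ m) \<partial>M)"
    unfolding potential_def
  proof (rule integral_mono)
    fix \<omega> assume "\<omega> \<in> space M"
    let ?e = "excess (\<zeta> \<omega>)"
    have "?e > u / 2 \<longleftrightarrow> \<zeta> \<omega> < - (u / 2)" and eq: "?e > u / 2 \<Longrightarrow> ?e = - \<zeta> \<omega>"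
      using assms(2) by (auto simp: excess_def)
    moreover have "?e * (?e / (?e + u)) ^ m \<le> ?e * (of_bool (?e > u / 2) + (2 / 3) ^ m * (?e / (?e + u / 2)) ^ m)"
      using kernel_halving_bound[OF excess_pos, of u "\<zeta> \<omega>" m] excess_pos[of "\<zeta> \<omega>"] assms(2)
      by (intro mult_left_mono) auto
    moreover have "?e * of_bool (?e > u / 2) = - \<zeta> \<omega> * of_bool (\<zeta> \<omega> < - (u / 2))"
      using calculation(1) eq by (auto simp: of_bool_def)
    ultimately show "?e * (?e / (?e + u)) ^ m \<le> - \<zeta> \<omega> * of_bool (\<zeta> \<omega> < - (u / 2))
      + (2 / 3) ^ m * (?e * (?e / (?e + u / 2)) ^ m)"
      by (simp add: distrib_left mult.left_commute del: power_divide)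
  qed (intro integrable_potential_kernel \<zeta> u2 Bochner_Integration.integrable_add integrable_mult_right int_i)+
  also have "\<dots> = (\<integral>\<omega>. - \<zeta> \<omega> * of_bool (\<zeta> \<omega> < - (u / 2)) \<partial>M)
      + (2 / 3) ^ m * potential M m \<zeta> (u / 2)"
    unfolding potential_def
    by (subst Bochner_Integration.integral_add[OF int_i integrable_mult_right[OF int_k]])
      (simp only: integral_mult_right_zero)
  finally show ?thesis .
qed

lemma potential_slope_smallo:
  assumes [measurable]: "\<zeta> \<in> borel_measurable M"
    and p: "\<And>x. p x > 0" "antimono p" "dilation_bounded p"
    and m: "\<forall>\<^sub>F x in at_top. 2 * (2 / 3) ^ m * p (x / 2) \<le> p x / 2"
    and o: "(\<lambda>x. x * prob {\<omega>\<in>space M. \<zeta> \<omega> < - x}) \<in> o[at_top](p)"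
  shows "(\<lambda>x. x * potential_slope M m \<zeta> x) \<in> o[at_top](p)"
proof (rule smallo_of_halving_recursion[where ?x0.0 = 2 and B = 1 and q = "2 * (2 / 3) ^ m"
    and J = "\<lambda>x. x * prob {\<omega>\<in>space M. \<zeta> \<omega> < - (x / 2)}"])
  show "(\<lambda>x. x * prob {\<omega>\<in>space M. \<zeta> \<omega> < - (x / 2)}) \<in> o[at_top](p)"
  proof -
    have "(\<lambda>x. 2 * (1 / 2 * x * prob {\<omega>\<in>space M. \<zeta> \<omega> < - (1 / 2 * x)})) \<in> o[at_top](p)"
      using smallo_dilate[OF p(1,3) o, of "1 / 2"] by simp
    then show ?thesis by (simp add: mult_ac)
  qed
next
  fix x :: real assume x: "x \<ge> 2"
  show "0 \<le> x * potential_slope M m \<zeta> x" using x potential_slope_nonneg by auto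
  have "potential_slope M m \<zeta> x \<le> (\<integral>\<omega>. 1 \<partial>M)"
    unfolding potential_slope_def using x
    by (intro integral_mono integrable_slope_kernel kernel_le_1 integrable_const) auto
  then show "x * potential_slope M m \<zeta> x \<le> 1 * x" using x by (simp add: prob_space)
  have "x * potential_slope M m \<zeta> x \<le> x * (prob {\<omega>\<in>space M. \<zeta> \<omega> < - (x / 2)} + (2 / 3) ^ m * potential_slope M m \<zeta> (x / 2))"
    using potential_slope_halving[of \<zeta> x m] x by (intro mult_left_mono) auto
  then show "x * potential_slope M m \<zeta> x \<le> x * prob {\<omega>\<in>space M. \<zeta> \<omega> < - (x / 2)}
    + 2 * (2 / 3) ^ m * (x / 2 * potential_slope M m \<zeta> (x / 2))"
    by (simp add: algebra_simps)
qed (use p m in auto)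

lemma potential_smallo:
  assumes \<zeta>: "integrable M \<zeta>"
    and p: "\<And>x. p x > 0" "antimono p" "dilation_bounded p"
    and m: "\<forall>\<^sub>F x in at_top. 2 * (2 / 3) ^ m * p (x / 2) \<le> p x / 2"
    and o: "(\<lambda>x. \<integral>\<omega>. - \<zeta> \<omega> * of_bool (\<zeta> \<omega> < - x) \<partial>M) \<in> o[at_top](p)"
  shows "potential M m \<zeta> \<in> o[at_top](p)"
proof (rule smallo_of_halving_recursion[where ?x0.0 = 2 and B = "\<integral>\<omega>. excess (\<zeta> \<omega>) \<partial>M" and q = "(2 / 3) ^ m"
    and J = "\<lambda>x. \<integral>\<omega>. - \<zeta> \<omega> * of_bool (\<zeta> \<omega> < - (x / 2)) \<partial>M"])
  show "(\<lambda>x. \<integral>\<omega>. - \<zeta> \<omega> * of_bool (\<zeta> \<omega> < - (x / 2)) \<partial>M) \<in> o[at_top](p)"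
    using smallo_dilate[OF p(1,3) o, of "1 / 2"] by simp
  show "\<forall>\<^sub>F x in at_top. (2 / 3) ^ m * p (x / 2) \<le> p x / 2"
    using m
  proof eventually_elim
    case (elim x)
    have "0 \<le> (2 / 3) ^ m * p (x / 2)" using p(1)[of "x / 2"] by simp
    then show ?case using elim by linarith
  qed
  show E0: "0 \<le> (\<integral>\<omega>. excess (\<zeta> \<omega>) \<partial>M)"
    using excess_pos by (intro integral_nonneg_AE) (auto simp: less_imp_le)
  fix x :: real assume x: "x \<ge> 2"
  show "0 \<le> potential M m \<zeta> x" using x potential_nonneg by auto
  have "potential M m \<zeta> x \<le> (\<integral>\<omega>. excess (\<zeta> \<omega>) \<partial>M)"
    unfolding potential_def
  proof (intro integral_mono integrable_potential_kernel integrable_excess \<zeta>)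
    fix \<omega> show "excess (\<zeta> \<omega>) * (excess (\<zeta> \<omega>) / (excess (\<zeta> \<omega>) + x)) ^ m \<le> excess (\<zeta> \<omega>)"
      using kernel_le_1[of x "\<zeta> \<omega>" m] x excess_pos[of "\<zeta> \<omega>"] by (simp add: mult_left_le del: power_divide)
  qed (use x in simp)
  also have "\<dots> \<le> (\<integral>\<omega>. excess (\<zeta> \<omega>) \<partial>M) * x" using E0 x by (simp add: mult_le_cancel_left1)
  finally show "potential M m \<zeta> x \<le> (\<integral>\<omega>. excess (\<zeta> \<omega>) \<partial>M) * x" .
  show "potential M m \<zeta> x \<le> (\<integral>\<omega>. - \<zeta> \<omega> * of_bool (\<zeta> \<omega> < - (x / 2)) \<partial>M) + (2 / 3) ^ m * potential M m \<zeta> (x / 2)"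
    using potential_halving[OF \<zeta> x] .
qed (use p in auto)

end

section \<open>Intermediate regular variation and asymptotic comparison\<close>

lemma irv_dilation:
  assumes irv: "intermediate_regularly_varying G" and "\<eta> > 0"
  shows "\<exists>\<epsilon>>0. \<epsilon> < 1 \<and> (\<forall>\<^sub>F x in at_top. tail G ((1 - \<epsilon>) * x) \<le> (1 + \<eta>) * tail G x)"
proof -
  have pos: "tail G x > 0" for x using irv by (auto simp: intermediate_regularly_varying_def)
  have "((\<lambda>\<epsilon>. Limsup at_top (\<lambda>x. ereal (tail G ((1 - \<epsilon>) * x) / tail G x))) \<longlongrightarrow> 1) (at_right 0)"
    using irv by (simp add: intermediate_regularly_varying_def)
  then have "\<forall>\<^sub>F \<epsilon> in at_right 0. Limsup at_top (\<lambda>x. ereal (tail G ((1 - \<epsilon>) * x) / tail G x)) < ereal (1 + \<eta>)"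
    using \<open>\<eta> > 0\<close> by (intro order_tendstoD(2)) (auto simp: one_ereal_def)
  moreover have "\<forall>\<^sub>F \<epsilon>::real in at_right 0. 0 < \<epsilon> \<and> \<epsilon> < 1"
    using eventually_at_right_real[of 0 1] by (auto elim: eventually_mono)
  ultimately have "\<forall>\<^sub>F \<epsilon> in at_right 0. 0 < \<epsilon> \<and> \<epsilon> < 1 \<and>
      Limsup at_top (\<lambda>x. ereal (tail G ((1 - \<epsilon>) * x) / tail G x)) < ereal (1 + \<eta>)"
    by eventually_elim auto
  then obtain \<epsilon> where \<epsilon>: "0 < \<epsilon>" "\<epsilon> < 1"
    "Limsup at_top (\<lambda>x. ereal (tail G ((1 - \<epsilon>) * x) / tail G x)) < ereal (1 + \<eta>)"
    using eventually_happens'[OF trivial_limit_at_right_real] by blast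
  have "\<forall>\<^sub>F x in at_top. ereal (tail G ((1 - \<epsilon>) * x) / tail G x) < ereal (1 + \<eta>)"
    using \<epsilon>(3) by (rule Limsup_lessD)
  then have "\<forall>\<^sub>F x in at_top. tail G ((1 - \<epsilon>) * x) \<le> (1 + \<eta>) * tail G x"
    by eventually_elim (use pos in \<open>simp add: divide_less_eq less_imp_le\<close>)
  then show ?thesis using \<epsilon> by blast
qed

lemma smallo_undilate:
  assumes p: "\<And>x. p x > (0::real)" "dilation_bounded p" and f: "f \<in> o[at_top](p)" and "a > 0"
  shows "f \<in> o[at_top](\<lambda>x. p (x / a) :: real)"
proof -
  obtain K where K: "\<forall>\<^sub>F x in at_top. p (a * x) \<le> K * p x"
    using p(2) \<open>a > 0\<close> by (auto simp: dilation_bounded_def)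
  have "filterlim (\<lambda>x::real. x / a) at_top at_top"
    using \<open>a > 0\<close> by real_asymp
  with K have "\<forall>\<^sub>F x in at_top. p (a * (x / a)) \<le> K * p (x / a)"
    by (rule eventually_compose_filterlim)
  then have "p \<in> O[at_top](\<lambda>x. p (x / a))"
    using p(1) \<open>a > 0\<close> by (intro bigoI[of _ K]) (auto simp: less_imp_le)
  with f show ?thesis by (rule landau_o.small_big_trans)
qed

lemma asymp_leI:
  assumes g: "\<And>x. g x > 0" and le: "\<And>\<eta>. \<eta> > 0 \<Longrightarrow> \<forall>\<^sub>F x in at_top. f x \<le> (1 + \<eta>) * g x"
  shows "asymp_le f g"
  unfolding asymp_le_def
proof (rule ereal_le_epsilon2)
  fix \<eta> :: real assume "\<eta> > 0"
  have "\<forall>\<^sub>F x in at_top. ereal (f x / g x) \<le> 1 + ereal \<eta>"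
    using le[OF \<open>\<eta> > 0\<close>]
    by eventually_elim (use g in \<open>simp add: divide_le_eq one_ereal_def\<close>)
  then show "Limsup at_top (\<lambda>x. ereal (f x / g x)) \<le> 1 + ereal \<eta>" by (rule Limsup_bounded)
qed

lemma asymp_geI:
  assumes g: "\<And>x. g x > 0" and ge: "\<And>\<eta>. \<eta> > 0 \<Longrightarrow> \<forall>\<^sub>F x in at_top. (1 - \<eta>) * g x \<le> f x"
  shows "asymp_ge f g"
  unfolding asymp_ge_def
proof (rule ereal_le_epsilon2)
  fix \<eta> :: real assume "\<eta> > 0"
  have "\<forall>\<^sub>F x in at_top. ereal (1 - \<eta>) \<le> ereal (f x / g x)"
    using ge[OF \<open>\<eta> > 0\<close>]
    by eventually_elim (use g in \<open>simp add: le_divide_eq\<close>)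
  then have "ereal (1 - \<eta>) \<le> Liminf at_top (\<lambda>x. ereal (f x / g x))" by (rule Liminf_bounded)
  then have "ereal (1 - \<eta>) + ereal \<eta> \<le> Liminf at_top (\<lambda>x. ereal (f x / g x)) + ereal \<eta>"
    by (rule add_right_mono)
  then show "1 \<le> Liminf at_top (\<lambda>x. ereal (f x / g x)) + ereal \<eta>" by (simp add: one_ereal_def)
qed

lemma asymp_equiv_of_bounds:
  fixes f g :: "real \<Rightarrow> real"
  assumes g: "\<And>x. g x > 0" and le: "\<And>\<eta>. \<eta> > 0 \<Longrightarrow> \<forall>\<^sub>F x in at_top. f x \<le> (1 + \<eta>) * g x"
    and ge: "\<And>\<eta>. \<eta> > 0 \<Longrightarrow> \<forall>\<^sub>F x in at_top. (1 - \<eta>) * g x \<le> f x"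
  shows "f \<sim>[at_top] g"
proof (rule asymp_equivI', rule tendstoI)
  fix e :: real assume "e > 0"
  then have "e / 2 > 0" by simp
  show "\<forall>\<^sub>F x in at_top. dist (f x / g x) 1 < e"
    using le[OF \<open>e / 2 > 0\<close>] ge[OF \<open>e / 2 > 0\<close>]
  proof eventually_elim
    case (elim x)
    have "f x / g x \<le> 1 + e / 2" "1 - e / 2 \<le> f x / g x"
      using elim g[of x] by (simp_all add: divide_le_eq le_divide_eq)
    then show ?case using \<open>e > 0\<close> by (simp add: dist_real_def abs_less_iff)
  qed
qed

context prob_space
begin

section \<open>Tails of the step\<close>

lemma integrated_left_tail_eq:
  assumes [measurable]: "X \<in> borel_measurable M"
  shows "(LBINT y:{x<..}. prob {\<omega>\<in>space M. X \<omega> < - y}) = (\<integral>\<omega>. max 0 (- X \<omega> - x) \<partial>M)"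
proof -
  interpret pair_sigma_finite lborel M ..
  define P where "P y = prob {\<omega>\<in>space M. X \<omega> < - y}" for y
  have P_eq: "P y = (\<integral>\<omega>. of_bool (X \<omega> < - y) \<partial>M)" for y
  proof -
    have "(\<integral>\<omega>. of_bool (X \<omega> < - y) \<partial>M) = (\<integral>\<omega>. indicator {\<omega>\<in>space M. X \<omega> < - y} \<omega> \<partial>M)"
      by (intro Bochner_Integration.integral_cong) (auto simp: indicator_def)
    also have "\<dots> = P y" by (simp add: P_def)
    finally show ?thesis by simp
  qed
  have [measurable]: "P \<in> borel_measurable borel" unfolding P_eq by measurable
  have slice: "ennreal (indicator {x<..} y *\<^sub>R P y)
    = (\<integral>\<^sup>+\<omega>. of_bool (x < y \<and> X \<omega> < - y) \<partial>M)" for y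
  proof (cases "x < y")
    case True
    have "(\<integral>\<^sup>+\<omega>. of_bool (x < y \<and> X \<omega> < - y) \<partial>M) = (\<integral>\<^sup>+\<omega>. indicator {\<omega>\<in>space M. X \<omega> < - y} \<omega> \<partial>M)"
      using True by (intro nn_integral_cong) (auto simp: indicator_def)
    then show ?thesis using True by (simp add: emeasure_eq_measure P_def)
  qed simp
  have inner: "(\<integral>\<^sup>+y. of_bool (x < y \<and> X \<omega> < - y) \<partial>lborel) = ennreal (max 0 (- X \<omega> - x))" for \<omega>
  proof -
    have "(\<integral>\<^sup>+y. of_bool (x < y \<and> X \<omega> < - y) \<partial>lborel) = (\<integral>\<^sup>+y. indicator {x<..<- X \<omega>} y \<partial>lborel)"
      by (intro nn_integral_cong) (auto simp: indicator_def)
    also have "\<dots> = emeasure lborel {x<..<- X \<omega>}" by simp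
    also have "\<dots> = ennreal (max 0 (- X \<omega> - x))"
      by (cases "x \<le> - X \<omega>") auto
    finally show ?thesis .
  qed
  have "(LBINT y:{x<..}. P y) = enn2real (\<integral>\<^sup>+y. ennreal (indicator {x<..} y *\<^sub>R P y) \<partial>lborel)"
    unfolding set_lebesgue_integral_def by (intro integral_eq_nn_integral) (auto simp: P_def)
  also have "(\<integral>\<^sup>+y. ennreal (indicator {x<..} y *\<^sub>R P y) \<partial>lborel)
    = (\<integral>\<^sup>+\<omega>. (\<integral>\<^sup>+y. of_bool (x < y \<and> X \<omega> < - y) \<partial>lborel) \<partial>M)"
    unfolding slice by (rule Fubini'[symmetric]) measurable
  also have "enn2real \<dots> = (\<integral>\<omega>. max 0 (- X \<omega> - x) \<partial>M)"
    unfolding inner by (intro integral_eq_nn_integral[symmetric]) auto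
  finally show ?thesis by (simp add: P_def)
qed

text \<open>
On \<open>X - s < - x\<close> with \<open>x \<ge> 4 * \<bar>s\<bar>\<close>, \<open>- X\<close> exceeds \<open>x / 4\<close> by at least half of
\<open>- (X - s)\<close>, so the truncated mean is at most twice the integrated tail from \<open>x / 4\<close>. The shift \<open>s\<close> and the
change of level are both absorbed by dilation.
\<close>
lemma left_tail_mean_smallo:
  assumes X: "integrable M X"
    and p: "\<And>x. p x > 0" "dilation_bounded p"
    and L: "(\<lambda>x. LBINT y:{x<..}. prob {\<omega>\<in>space M. X \<omega> < - y}) \<in> o[at_top](p)"
  shows "(\<lambda>x. \<integral>\<omega>. - (X \<omega> - s) * of_bool (X \<omega> - s < - x) \<partial>M) \<in> o[at_top](p)"
proof -
  have [measurable]: "X \<in> borel_measurable M" using X by auto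
  have int_max: "integrable M (\<lambda>\<omega>. max 0 (- X \<omega> - y))" for y using X by auto
  have int_l: "integrable M (\<lambda>\<omega>. - (X \<omega> - s) * of_bool (X \<omega> - s < - x))" for x
    by (rule Bochner_Integration.integrable_bound[of M "\<lambda>\<omega>. X \<omega> - s"]) (use X in auto)
  have "(\<lambda>x. \<integral>\<omega>. max 0 (- X \<omega> - x) \<partial>M) \<in> o[at_top](p)"
    using L unfolding integrated_left_tail_eq[OF \<open>X \<in> borel_measurable M\<close>] .
  from smallo_dilate[OF p this, of "1 / 4"]
  have "(\<lambda>x. \<integral>\<omega>. max 0 (- X \<omega> - 1 / 4 * x) \<partial>M) \<in> o[at_top](p)" by simp
  moreover have "(\<lambda>x. \<integral>\<omega>. - (X \<omega> - s) * of_bool (X \<omega> - s < - x) \<partial>M)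
    \<in> O[at_top](\<lambda>x. \<integral>\<omega>. max 0 (- X \<omega> - 1 / 4 * x) \<partial>M)"
  proof (rule bigoI[of _ 2])
    show "\<forall>\<^sub>F x in at_top. norm (\<integral>\<omega>. - (X \<omega> - s) * of_bool (X \<omega> - s < - x) \<partial>M)
      \<le> 2 * norm (\<integral>\<omega>. max 0 (- X \<omega> - 1 / 4 * x) \<partial>M)"
      using eventually_ge_at_top[of "4 * \<bar>s\<bar>"]
    proof eventually_elim
      case (elim x)
      have "(\<integral>\<omega>. - (X \<omega> - s) * of_bool (X \<omega> - s < - x) \<partial>M) \<le> (\<integral>\<omega>. 2 * max 0 (- X \<omega> - 1 / 4 * x) \<partial>M)"
      proof (intro integral_mono int_l integrable_mult_right int_max)
        fix \<omega>
        show "- (X \<omega> - s) * of_bool (X \<omega> - s < - x) \<le> 2 * max 0 (- X \<omega> - 1 / 4 * x)"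
          using elim by (auto simp: of_bool_def max_def abs_if split: if_splits)
      qed
      moreover have "0 \<le> (\<integral>\<omega>. - (X \<omega> - s) * of_bool (X \<omega> - s < - x) \<partial>M)"
        using elim by (intro integral_nonneg_AE AE_I2) (auto simp: of_bool_def abs_if split: if_splits)
      moreover have "0 \<le> (\<integral>\<omega>. max 0 (- X \<omega> - 1 / 4 * x) \<partial>M)" by (intro integral_nonneg_AE AE_I2) auto
      ultimately show ?case by simp
    qed
  qed
  ultimately show ?thesis by (rule landau_o.big_small_trans[rotated])
qed

section \<open>Early and late passage of the walk\<close>

text \<open>
After truncation the factor \<open>excess\<close> is at most \<open>x\<close>, so only the tail of \<open>\<zeta>\<close> and not its
integral is involved. This is why (U) suffices for the early passage.
\<close>
lemma truncated_potential_le: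
  assumes [measurable]: "\<zeta> \<in> borel_measurable M" and "x \<ge> 1" "u > 0"
  shows "potential M m (\<lambda>\<omega>. max (\<zeta> \<omega>) (- x)) u \<le> x * potential_slope M m \<zeta> u"
proof -
  have bound: "0 \<le> excess (max w (- x)) * (excess (max w (- x)) / (excess (max w (- x)) + u)) ^ m"
    "excess (max w (- x)) * (excess (max w (- x)) / (excess (max w (- x)) + u)) ^ m
      \<le> x * (excess w / (excess w + u)) ^ m" for w
  proof -
    have e: "excess (max w (- x)) \<le> x" "excess (max w (- x)) \<le> excess w"
      using assms by (auto simp: excess_def)
    have "excess (max w (- x)) / (excess (max w (- x)) + u) \<le> excess w / (excess w + u)"
      using e(2) assms excess_pos[of w] excess_pos[of "max w (- x)"] by (simp add: field_simps)
    then have "(excess (max w (- x)) / (excess (max w (- x)) + u)) ^ m \<le> (excess w / (excess w + u)) ^ m"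
      using excess_pos[of "max w (- x)"] assms by (intro power_mono) auto
    then show "excess (max w (- x)) * (excess (max w (- x)) / (excess (max w (- x)) + u)) ^ m
      \<le> x * (excess w / (excess w + u)) ^ m"
      using e(1) assms kernel_nonneg[of u "max w (- x)" m] by (intro mult_mono) auto
    show "0 \<le> excess (max w (- x)) * (excess (max w (- x)) / (excess (max w (- x)) + u)) ^ m"
      using kernel_nonneg[of u "max w (- x)" m] excess_pos[of "max w (- x)"] assms
      by (intro mult_nonneg_nonneg) auto
  qed
  have int: "integrable M (\<lambda>\<omega>. x * (excess (\<zeta> \<omega>) / (excess (\<zeta> \<omega>) + u)) ^ m)"
    using assms by (intro integrable_mult_right integrable_slope_kernel) auto
  have "potential M m (\<lambda>\<omega>. max (\<zeta> \<omega>) (- x)) u \<le> (\<integral>\<omega>. x * (excess (\<zeta> \<omega>) / (excess (\<zeta> \<omega>) + u)) ^ m \<partial>M)"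
    unfolding potential_def
    by (rule integral_mono'[OF int]) (use bound order_trans[OF bound] in auto)
  also have "\<dots> = x * potential_slope M m \<zeta> u"
    unfolding potential_slope_def by (simp only: integral_mult_right_zero)
  finally show ?thesis .
qed

lemma prob_distr_eq:
  assumes "distr M borel Y = distr M borel X" "Y \<in> borel_measurable M" "X \<in> borel_measurable M"
  shows "prob {\<omega>\<in>space M. Y \<omega> > x} = prob {\<omega>\<in>space M. X \<omega> > (x::real)}"
proof -
  have "measure (distr M borel Z) {x<..} = prob {\<omega>\<in>space M. Z \<omega> > x}" if "Z \<in> borel_measurable M" for Z
    using that by (subst measure_distr) (auto intro!: arg_cong[where f = prob])
  then show ?thesis using assms by metis
qed

lemma distr_compose_eq:
  assumes "distr M borel Y = distr M borel X" "Y \<in> borel_measurable M" "X \<in> borel_measurable M"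
    and "\<phi> \<in> borel_measurable borel"
  shows "distr M borel (\<lambda>\<omega>. \<phi> (Y \<omega>) :: real) = distr M borel (\<lambda>\<omega>. \<phi> (X \<omega> :: real))"
proof -
  have "distr M borel (\<lambda>\<omega>. \<phi> (Z \<omega>)) = distr (distr M borel Z) borel \<phi>" if "Z \<in> borel_measurable M" for Z
    using that assms(4) by (simp add: distr_distr comp_def)
  then show ?thesis using assms by metis
qed

text \<open>
With \<open>d = a * \<epsilon> / 2\<close>, a walk above \<open>x\<close> at a time \<open>n \<le> (1 - \<epsilon>) * x / a\<close> lies above the line
\<open>n * (a + d)\<close> by at least \<open>\<epsilon> / 2 * x\<close>, as \<open>(1 - \<epsilon>) * (1 + \<epsilon> / 2) \<le> 1 - \<epsilon> / 2\<close>. So the walk with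
steps \<open>a + d - \<xi> i\<close>, started at \<open>\<epsilon> / 2 * x\<close>, is ruined, and unless some \<open>\<xi> i\<close> exceeds \<open>x\<close>,
cutting its steps off at \<open>- x\<close> does not change it.
\<close>
lemma early_passage_smallo:
  fixes \<xi> :: "nat \<Rightarrow> 'a \<Rightarrow> real"
  assumes indep: "indep_vars (\<lambda>_. borel) \<xi> {1..}"
    and ident: "\<And>n. n \<ge> 1 \<Longrightarrow> distr M borel (\<xi> n) = distr M borel X"
    and X: "integrable M X" and a: "a = (\<integral>\<omega>. X \<omega> \<partial>M)" "a > 0"
    and p: "\<And>x. p x > 0" "antimono p" "dilation_bounded p"
    and U: "(\<lambda>x. x * prob {\<omega>\<in>space M. X \<omega> > x}) \<in> o[at_top](p)"
    and \<epsilon>: "0 < \<epsilon>" "\<epsilon> < 1"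
  shows "(\<lambda>x. prob {\<omega>\<in>space M. \<exists>n. real n \<le> (1 - \<epsilon>) * (x / a) \<and> x < random_walk \<xi> n \<omega>}) \<in> o[at_top](p)"
proof -
  define d where "d = a * \<epsilon> / 2"
  define c where "c = \<epsilon> / 2"
  define \<zeta> where "\<zeta> \<omega> = a + d - X \<omega>" for \<omega>
  have d: "d > 0" and c: "c > 0" using \<epsilon> a by (auto simp: d_def c_def)
  have [measurable]: "X \<in> borel_measurable M" using X by auto
  have rv [measurable]: "\<xi> i \<in> borel_measurable M" if "i \<ge> 1" for i
    using indep that by (auto simp: indep_vars_def2)
  have \<zeta>: "integrable M \<zeta>" "(\<integral>\<omega>. \<zeta> \<omega> \<partial>M) = d"
    unfolding \<zeta>_def using X a(1) by (auto simp: prob_space)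
  have [measurable]: "\<zeta> \<in> borel_measurable M" using \<zeta> by auto
  obtain m where m: "m \<ge> 1" "\<forall>\<^sub>F x in at_top. 2 * (2 / 3) ^ m * p (x / 2) \<le> p x / 2"
    using ex_exponent[OF p(1,3)] by blast
  obtain C where C: "C > 0" and ruin: "\<And>\<zeta>' \<eta> n u. integrable M \<zeta>' \<Longrightarrow> (\<And>\<omega>. \<zeta> \<omega> \<le> \<zeta>' \<omega>)
    \<Longrightarrow> indep_vars (\<lambda>_. borel) \<eta> {1..}
    \<Longrightarrow> (\<And>i. i \<ge> 1 \<Longrightarrow> distr M borel (\<eta> i) = distr M borel \<zeta>') \<Longrightarrow> 0 < u
    \<Longrightarrow> prob {\<omega>\<in>space M. ruin_by n u (\<lambda>i. \<eta> i \<omega>)} \<le> C * potential M m \<zeta>' u"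
    by (rule ex_uniform_ruin_bound[OF \<zeta>(1) _ m(1)]) (use \<zeta>(2) d in auto)
  have "(\<lambda>x. x * prob {\<omega>\<in>space M. \<zeta> \<omega> < - x}) \<in> o[at_top](p)"
  proof (rule landau_o.big_small_trans[OF _ U], rule bigoI[of _ 1])
    show "\<forall>\<^sub>F x in at_top. norm (x * prob {\<omega>\<in>space M. \<zeta> \<omega> < - x}) \<le> 1 * norm (x * prob {\<omega>\<in>space M. X \<omega> > x})"
      using eventually_ge_at_top[of 0]
    proof eventually_elim
      case (elim x)
      have "prob {\<omega>\<in>space M. \<zeta> \<omega> < - x} \<le> prob {\<omega>\<in>space M. X \<omega> > x}"
        using a d by (intro finite_measure_mono) (auto simp: \<zeta>_def)
      then show ?case using elim by (simp add: mult_left_mono)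
    qed
  qed
  from potential_slope_smallo[OF _ p m(2) this]
  have "(\<lambda>x. x * potential_slope M m \<zeta> x) \<in> o[at_top](p)" by simp
  from smallo_dilate[OF p(1,3) this c]
  have slope: "(\<lambda>x. C / c * (c * x * potential_slope M m \<zeta> (c * x))) \<in> o[at_top](p)"
    by (subst landau_o.small.cmult_in_iff) (use C c in auto)
  have "(\<lambda>x. 1 / a * (x * prob {\<omega>\<in>space M. X \<omega> > x})) \<in> o[at_top](p)"
    using U a by simp
  from sum_in_smallo(1)[OF this slope]
  have bound: "(\<lambda>x. 1 / a * (x * prob {\<omega>\<in>space M. X \<omega> > x}) + C / c * (c * x * potential_slope M m \<zeta> (c * x))) \<in> o[at_top](p)" .
  have main: "prob {\<omega>\<in>space M. \<exists>n. real n \<le> (1 - \<epsilon>) * (x / a) \<and> x < random_walk \<xi> n \<omega>}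
      \<le> 1 / a * (x * prob {\<omega>\<in>space M. X \<omega> > x}) + C / c * (c * x * potential_slope M m \<zeta> (c * x))"
    if x: "x \<ge> 1" for x
  proof -
    define N where "N = nat \<lfloor>(1 - \<epsilon>) * (x / a)\<rfloor>"
    define \<phi> where "\<phi> w = max (a + d - w) (- x)" for w
    have [measurable]: "\<phi> \<in> borel_measurable borel" unfolding \<phi>_def by measurable
    let ?big = "\<Union>i\<in>{1..N}. {\<omega>\<in>space M. \<xi> i \<omega> > x}"
    let ?ruin = "{\<omega>\<in>space M. ruin_by N (c * x) (\<lambda>i. \<phi> (\<xi> i \<omega>))}"
    have indep': "indep_vars (\<lambda>_. borel) (\<lambda>i \<omega>. \<phi> (\<xi> i \<omega>)) {1..}"
      by (rule indep_vars_compose2[OF indep]) measurable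
    have rv' [measurable]: "(\<lambda>\<omega>. \<phi> (\<xi> i \<omega>)) \<in> borel_measurable M" if "i \<ge> 1" for i
      using that by measurable
    have ruin_sets: "?ruin \<in> events"
    proof -
      have "?ruin = (\<Union>k\<in>{..N}. {\<omega>\<in>space M. c * x + (\<Sum>i=1..k. \<phi> (\<xi> i \<omega>)) \<le> 0})"
        by (auto simp: ruin_by_def)
      also have "\<dots> \<in> events"
        by (intro sets.finite_UN) (auto intro!: borel_measurable_sum rv' borel_measurable_le borel_measurable_add)
      finally show ?thesis .
    qed
    have big_sets: "?big \<in> events" by (intro sets.finite_UN) auto
    have "{\<omega>\<in>space M. \<exists>n. real n \<le> (1 - \<epsilon>) * (x / a) \<and> x < random_walk \<xi> n \<omega>} \<subseteq> ?big \<union> ?ruin"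
    proof (rule subsetI)
      fix \<omega> assume "\<omega> \<in> {\<omega>\<in>space M. \<exists>n. real n \<le> (1 - \<epsilon>) * (x / a) \<and> x < random_walk \<xi> n \<omega>}"
      then obtain n where \<omega>: "\<omega> \<in> space M" and n: "real n \<le> (1 - \<epsilon>) * (x / a)" "x < random_walk \<xi> n \<omega>"
        by auto
      have nN: "n \<le> N" using n(1) by (simp add: N_def le_nat_floor)
      show "\<omega> \<in> ?big \<union> ?ruin"
      proof (cases "\<omega> \<in> ?big")
        case False
        have "(\<Sum>i=1..n. \<phi> (\<xi> i \<omega>)) = (\<Sum>i=1..n. (a + d) - \<xi> i \<omega>)"
        proof (intro sum.cong refl)
          fix i assume "i \<in> {1..n}"
          then have "\<xi> i \<omega> \<le> x" using False \<omega> nN by (fastforce simp: not_less)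
          then show "\<phi> (\<xi> i \<omega>) = (a + d) - \<xi> i \<omega>" using a d by (simp add: \<phi>_def)
        qed
        also have "\<dots> = real n * (a + d) - random_walk \<xi> n \<omega>"
          by (simp add: sum_subtractf random_walk_def)
        also have "real n * (a + d) \<le> (1 - \<epsilon>) * (x / a) * (a + d)"
          using n(1) a d by (intro mult_right_mono) auto
        also have "\<dots> = (1 - \<epsilon>) * (1 + \<epsilon> / 2) * x" using a by (simp add: d_def field_simps)
        also have "\<dots> \<le> (1 - \<epsilon> / 2) * x"
        proof (rule mult_right_mono)
          have "(1 - \<epsilon>) * (1 + \<epsilon> / 2) = 1 - \<epsilon> / 2 - \<epsilon> * \<epsilon> / 2" by (simp add: field_simps)
          then show "(1 - \<epsilon>) * (1 + \<epsilon> / 2) \<le> 1 - \<epsilon> / 2" using \<epsilon> by simp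
        qed (use x in simp)
        finally have "c * x + (\<Sum>i=1..n. \<phi> (\<xi> i \<omega>)) \<le> 0" using n(2) by (simp add: c_def algebra_simps)
        then show ?thesis using nN \<omega> by (auto simp: ruin_by_def)
      qed simp
    qed
    then have "prob {\<omega>\<in>space M. \<exists>n. real n \<le> (1 - \<epsilon>) * (x / a) \<and> x < random_walk \<xi> n \<omega>} \<le> prob (?big \<union> ?ruin)"
      by (intro finite_measure_mono sets.Un big_sets ruin_sets)
    also have "\<dots> \<le> prob ?big + prob ?ruin" by (intro measure_Un_le big_sets ruin_sets)
    also have "prob ?big \<le> 1 / a * (x * prob {\<omega>\<in>space M. X \<omega> > x})"
    proof -
      have "prob ?big \<le> (\<Sum>i\<in>{1..N}. prob {\<omega>\<in>space M. \<xi> i \<omega> > x})"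
        by (intro measure_UNION_le) auto
      also have "\<dots> = (\<Sum>i\<in>{1..N}. prob {\<omega>\<in>space M. X \<omega> > x})"
        by (intro sum.cong prob_distr_eq ident rv) auto
      also have "\<dots> = real N * prob {\<omega>\<in>space M. X \<omega> > x}" by simp
      also have "\<dots> \<le> (x / a) * prob {\<omega>\<in>space M. X \<omega> > x}"
      proof (rule mult_right_mono)
        have "0 \<le> (1 - \<epsilon>) * (x / a)" using \<epsilon> x a by simp
        then have "real N \<le> (1 - \<epsilon>) * (x / a)" unfolding N_def by linarith
        also have "\<dots> \<le> 1 * (x / a)" using \<epsilon> x a by (intro mult_right_mono) auto
        finally show "real N \<le> x / a" by simp
      qed simp
      finally show ?thesis by simp
    qed
    also have "prob ?ruin \<le> C * potential M m (\<lambda>\<omega>. max (\<zeta> \<omega>) (- x)) (c * x)"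
    proof (rule ruin[OF _ _ indep'])
      show "integrable M (\<lambda>\<omega>. max (\<zeta> \<omega>) (- x))" using \<zeta>(1) by (intro integrable_max) auto
      show "distr M borel (\<lambda>\<omega>. \<phi> (\<xi> i \<omega>)) = distr M borel (\<lambda>\<omega>. max (\<zeta> \<omega>) (- x))"
        if "i \<ge> 1" for i
        using distr_compose_eq[OF ident rv, of i \<phi>] that by (simp add: \<phi>_def \<zeta>_def)
    qed (use c x in auto)
    also have "potential M m (\<lambda>\<omega>. max (\<zeta> \<omega>) (- x)) (c * x) \<le> x * potential_slope M m \<zeta> (c * x)"
      using x c by (intro truncated_potential_le) auto
    finally show ?thesis using C c by simp
  qed
  show ?thesis
  proof (rule landau_o.big_small_trans[OF _ bound], rule bigoI[of _ 1])
    show "\<forall>\<^sub>F x in at_top. norm (prob {\<omega>\<in>space M. \<exists>n. real n \<le> (1 - \<epsilon>) * (x / a) \<and> x < random_walk \<xi> n \<omega>})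
      \<le> 1 * norm (1 / a * (x * prob {\<omega>\<in>space M. X \<omega> > x}) + C / c * (c * x * potential_slope M m \<zeta> (c * x)))"
      using eventually_ge_at_top[of 1]
    proof eventually_elim
      case (elim x)
      show ?case using main[OF elim] by (simp del: times_divide_eq_left)
    qed
  qed
qed

text \<open>
With \<open>d = a * \<epsilon> / 2\<close>, a walk at or below \<open>x\<close> at a time \<open>n > x / (a * (1 - \<epsilon>))\<close> lies below the line
\<open>n * (a - d)\<close> by at least \<open>\<epsilon> / 2 * x\<close>, as \<open>(1 - \<epsilon> / 2) / (1 - \<epsilon>) \<ge> 1 + \<epsilon> / 2\<close>. The ruin bound
does not depend on the horizon, so it extends to all \<open>n\<close> by continuity of the measure.
\<close>
lemma late_low_value_smallo:
  fixes \<xi> :: "nat \<Rightarrow> 'a \<Rightarrow> real"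
  assumes indep: "indep_vars (\<lambda>_. borel) \<xi> {1..}"
    and ident: "\<And>n. n \<ge> 1 \<Longrightarrow> distr M borel (\<xi> n) = distr M borel X"
    and X: "integrable M X" and a: "a = (\<integral>\<omega>. X \<omega> \<partial>M)" "a > 0"
    and p: "\<And>x. p x > 0" "antimono p" "dilation_bounded p"
    and L: "(\<lambda>x. LBINT y:{x<..}. prob {\<omega>\<in>space M. X \<omega> < - y}) \<in> o[at_top](p)"
    and \<epsilon>: "0 < \<epsilon>" "\<epsilon> < 1"
  shows "(\<lambda>x. prob {\<omega>\<in>space M. \<exists>n. real n > x / (a * (1 - \<epsilon>)) \<and> random_walk \<xi> n \<omega> \<le> x}) \<in> o[at_top](p)"
proof -
  define d where "d = a * \<epsilon> / 2"
  define c where "c = \<epsilon> / 2"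
  define \<zeta> where "\<zeta> \<omega> = X \<omega> - (a - d)" for \<omega>
  have d: "d > 0" "d < a" and c: "c > 0" using \<epsilon> a by (auto simp: d_def c_def)
  have [measurable]: "X \<in> borel_measurable M" using X by auto
  have rv [measurable]: "\<xi> i \<in> borel_measurable M" if "i \<ge> 1" for i
    using indep that by (auto simp: indep_vars_def2)
  have walk [measurable]: "random_walk \<xi> n \<in> borel_measurable M" for n
    unfolding random_walk_def[abs_def] by (intro borel_measurable_sum rv) auto
  have \<zeta>: "integrable M \<zeta>" "(\<integral>\<omega>. \<zeta> \<omega> \<partial>M) = d"
    unfolding \<zeta>_def using X a(1) by (auto simp: prob_space)
  obtain m where m: "m \<ge> 1" "\<forall>\<^sub>F x in at_top. 2 * (2 / 3) ^ m * p (x / 2) \<le> p x / 2"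
    using ex_exponent[OF p(1,3)] by blast
  obtain C where C: "C > 0" and ruin: "\<And>\<zeta>' \<eta> n u. integrable M \<zeta>' \<Longrightarrow> (\<And>\<omega>. \<zeta> \<omega> \<le> \<zeta>' \<omega>)
    \<Longrightarrow> indep_vars (\<lambda>_. borel) \<eta> {1..}
    \<Longrightarrow> (\<And>i. i \<ge> 1 \<Longrightarrow> distr M borel (\<eta> i) = distr M borel \<zeta>') \<Longrightarrow> 0 < u
    \<Longrightarrow> prob {\<omega>\<in>space M. ruin_by n u (\<lambda>i. \<eta> i \<omega>)} \<le> C * potential M m \<zeta>' u"
    by (rule ex_uniform_ruin_bound[OF \<zeta>(1) _ m(1)]) (use \<zeta>(2) d in auto)
  have "(\<lambda>x. \<integral>\<omega>. - \<zeta> \<omega> * of_bool (\<zeta> \<omega> < - x) \<partial>M) \<in> o[at_top](p)"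
    using left_tail_mean_smallo[OF X p(1,3) L, of "a - d"] by (simp only: \<zeta>_def)
  from smallo_dilate[OF p(1,3) potential_smallo[OF \<zeta>(1) p m(2) this] c]
  have bound: "(\<lambda>x. C * potential M m \<zeta> (c * x)) \<in> o[at_top](p)" using C by simp
  have main: "prob {\<omega>\<in>space M. \<exists>n. real n > x / (a * (1 - \<epsilon>)) \<and> random_walk \<xi> n \<omega> \<le> x}
      \<le> C * potential M m \<zeta> (c * x)" if x: "x > 0" for x
  proof -
    let ?F = "\<lambda>N. {\<omega>\<in>space M. \<exists>n\<le>N. real n > x / (a * (1 - \<epsilon>)) \<and> random_walk \<xi> n \<omega> \<le> x}"
    have F_sets: "?F N \<in> events" for N
    proof -
      have "?F N = (\<Union>n\<in>{n\<in>{..N}. real n > x / (a * (1 - \<epsilon>))}. {\<omega>\<in>space M. random_walk \<xi> n \<omega> \<le> x})" by auto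
      also have "\<dots> \<in> events" by (intro sets.finite_UN) auto
      finally show ?thesis .
    qed
    have F_le: "prob (?F N) \<le> C * potential M m \<zeta> (c * x)" for N
    proof -
      have indep': "indep_vars (\<lambda>_. borel) (\<lambda>i \<omega>. \<xi> i \<omega> - (a - d)) {1..}"
        by (rule indep_vars_compose2[OF indep]) measurable
      have sub: "?F N \<subseteq> {\<omega>\<in>space M. ruin_by N (c * x) (\<lambda>i. \<xi> i \<omega> - (a - d))}"
      proof (rule subsetI)
        fix \<omega> assume "\<omega> \<in> ?F N"
        then obtain n where \<omega>: "\<omega> \<in> space M" and n: "n \<le> N" "real n > x / (a * (1 - \<epsilon>))" "random_walk \<xi> n \<omega> \<le> x"
          by auto
        have "(\<Sum>i=1..n. \<xi> i \<omega> - (a - d)) = random_walk \<xi> n \<omega> - real n * (a - d)"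
          by (simp add: sum_subtractf random_walk_def)
        moreover have "x / (a * (1 - \<epsilon>)) * (a - d) \<le> real n * (a - d)"
          using n(2) d by (intro mult_right_mono) auto
        moreover have "(1 + \<epsilon> / 2) * x \<le> x / (a * (1 - \<epsilon>)) * (a - d)"
        proof -
          have "(1 + \<epsilon> / 2) * (1 - \<epsilon>) \<le> 1 - \<epsilon> / 2" using \<epsilon> by (simp add: algebra_simps)
          then have "(1 + \<epsilon> / 2) \<le> (1 - \<epsilon> / 2) / (1 - \<epsilon>)" using \<epsilon> by (simp add: pos_le_divide_eq)
          then have "(1 + \<epsilon> / 2) * x \<le> (1 - \<epsilon> / 2) / (1 - \<epsilon>) * x" using x by (intro mult_right_mono) auto
          also have "\<dots> = x / (a * (1 - \<epsilon>)) * (a - d)"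
          proof -
            have "a - d = a * (1 - \<epsilon> / 2)" by (simp add: d_def algebra_simps)
            then show ?thesis using a by simp
          qed
          finally show ?thesis .
        qed
        ultimately have "c * x + (\<Sum>i=1..n. \<xi> i \<omega> - (a - d)) \<le> 0"
          using n(3) by (simp add: c_def algebra_simps)
        then show "\<omega> \<in> {\<omega>\<in>space M. ruin_by N (c * x) (\<lambda>i. \<xi> i \<omega> - (a - d))}"
          using n \<omega> by (auto simp: ruin_by_def)
      qed
      have "{\<omega>\<in>space M. ruin_by N (c * x) (\<lambda>i. \<xi> i \<omega> - (a - d))}
          = (\<Union>k\<in>{..N}. {\<omega>\<in>space M. c * x + (\<Sum>i=1..k. \<xi> i \<omega> - (a - d)) \<le> 0})"
        by (auto simp: ruin_by_def)
      also have "\<dots> \<in> events"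
        by (intro sets.finite_UN borel_measurable_le borel_measurable_add borel_measurable_sum
            borel_measurable_diff rv) auto
      finally have "prob (?F N) \<le> prob {\<omega>\<in>space M. ruin_by N (c * x) (\<lambda>i. \<xi> i \<omega> - (a - d))}"
        using sub by (intro finite_measure_mono)
      also have "\<dots> \<le> C * potential M m \<zeta> (c * x)"
      proof (rule ruin[OF \<zeta>(1) _ indep'])
        show "distr M borel (\<lambda>\<omega>. \<xi> i \<omega> - (a - d)) = distr M borel \<zeta>"
          if "i \<ge> 1" for i
          using distr_compose_eq[OF ident rv, of i "\<lambda>w. w - (a - d)"] that by (simp add: \<zeta>_def[abs_def])
      qed (use c x in auto)
      finally show ?thesis .
    qed
    have "(\<lambda>N. prob (?F N)) \<longlonglongrightarrow> prob (\<Union>N. ?F N)"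
      using F_sets by (intro finite_Lim_measure_incseq) (auto simp: incseq_def intro: order_trans)
    then have "prob (\<Union>N. ?F N) \<le> C * potential M m \<zeta> (c * x)"
      using F_le by (intro LIMSEQ_le_const2) auto
    moreover have "(\<Union>N. ?F N) = {\<omega>\<in>space M. \<exists>n. real n > x / (a * (1 - \<epsilon>)) \<and> random_walk \<xi> n \<omega> \<le> x}"
      by auto
    ultimately show ?thesis by simp
  qed
  show ?thesis
  proof (rule landau_o.big_small_trans[OF _ bound], rule bigoI[of _ 1])
    show "\<forall>\<^sub>F x in at_top. norm (prob {\<omega>\<in>space M. \<exists>n. real n > x / (a * (1 - \<epsilon>)) \<and> random_walk \<xi> n \<omega> \<le> x})
      \<le> 1 * norm (C * potential M m \<zeta> (c * x))"
      using eventually_gt_at_top[of 0]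
    proof eventually_elim
      case (elim x)
      show ?case using main[OF elim] by simp
    qed
  qed
qed

section \<open>The walk at a random time\<close>

lemma tail_distr_real:
  assumes [measurable]: "\<tau> \<in> measurable M (count_space UNIV)"
  shows "tail (distr M borel (\<lambda>\<omega>. real (\<tau> \<omega>))) x = prob {\<omega>\<in>space M. real (\<tau> \<omega>) > x}"
  unfolding tail_def by (subst measure_distr) (auto intro!: arg_cong[where f = prob])

lemma measurable_at_random_time:
  assumes "\<And>n. n \<ge> 1 \<Longrightarrow> \<xi> n \<in> borel_measurable M" and [measurable]: "\<tau> \<in> measurable M (count_space UNIV)"
  shows "(\<lambda>\<omega>. random_walk \<xi> (\<tau> \<omega>) \<omega>) \<in> borel_measurable M"
    and "(\<lambda>\<omega>. running_max \<xi> (\<tau> \<omega>) \<omega>) \<in> borel_measurable M"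
proof -
  have [measurable]: "random_walk \<xi> n \<in> borel_measurable M" for n
    unfolding random_walk_def[abs_def] using assms by (intro borel_measurable_sum) auto
  have [measurable]: "running_max \<xi> n \<in> borel_measurable M" for n
    unfolding running_max_def[abs_def] by (intro borel_measurable_Max) auto
  show "(\<lambda>\<omega>. random_walk \<xi> (\<tau> \<omega>) \<omega>) \<in> borel_measurable M"
    by (rule measurable_compose_countable[OF _ assms(2)]) measurable
  show "(\<lambda>\<omega>. running_max \<xi> (\<tau> \<omega>) \<omega>) \<in> borel_measurable M"
    by (rule measurable_compose_countable[OF _ assms(2)]) measurable
qed

lemma running_max_tail_le:
  fixes \<xi> :: "nat \<Rightarrow> 'a \<Rightarrow> real"
  assumes rv: "\<And>n. n \<ge> 1 \<Longrightarrow> \<xi> n \<in> borel_measurable M" and tau [measurable]: "\<tau> \<in> measurable M (count_space UNIV)"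
  shows "prob {\<omega>\<in>space M. running_max \<xi> (\<tau> \<omega>) \<omega> > x}
    \<le> prob {\<omega>\<in>space M. real (\<tau> \<omega>) > b} + prob {\<omega>\<in>space M. \<exists>n. real n \<le> b \<and> x < random_walk \<xi> n \<omega>}"
proof -
  have [measurable]: "random_walk \<xi> n \<in> borel_measurable M" for n
    unfolding random_walk_def[abs_def] using rv by (intro borel_measurable_sum) auto
  let ?A = "{\<omega>\<in>space M. real (\<tau> \<omega>) > b}" and ?B = "{\<omega>\<in>space M. \<exists>n. real n \<le> b \<and> x < random_walk \<xi> n \<omega>}"
  have "prob {\<omega>\<in>space M. running_max \<xi> (\<tau> \<omega>) \<omega> > x} \<le> prob (?A \<union> ?B)"
  proof (rule finite_measure_mono)
    show "{\<omega>\<in>space M. running_max \<xi> (\<tau> \<omega>) \<omega> > x} \<subseteq> ?A \<union> ?B"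
    proof (rule subsetI)
      fix \<omega> assume "\<omega> \<in> {\<omega>\<in>space M. running_max \<xi> (\<tau> \<omega>) \<omega> > x}"
      then have \<omega>: "\<omega> \<in> space M" and max: "x < running_max \<xi> (\<tau> \<omega>) \<omega>" by auto
      obtain i where i: "i \<le> \<tau> \<omega>" "x < random_walk \<xi> i \<omega>"
        using max by (auto simp: running_max_def Max_gr_iff)
      show "\<omega> \<in> ?A \<union> ?B"
      proof (cases "real (\<tau> \<omega>) > b")
        case False
        then have "real i \<le> b" using i(1) by linarith
        then show ?thesis using i(2) \<omega> by auto
      qed (use \<omega> in simp)
    qed
  qed measurable
  also have "\<dots> \<le> prob ?A + prob ?B" by (intro measure_Un_le) measurable
  finally show ?thesis .
qed

lemma random_walk_tail_ge:
  fixes \<xi> :: "nat \<Rightarrow> 'a \<Rightarrow> real"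
  assumes rv: "\<And>n. n \<ge> 1 \<Longrightarrow> \<xi> n \<in> borel_measurable M" and tau [measurable]: "\<tau> \<in> measurable M (count_space UNIV)"
  shows "prob {\<omega>\<in>space M. real (\<tau> \<omega>) > b}
    \<le> prob {\<omega>\<in>space M. random_walk \<xi> (\<tau> \<omega>) \<omega> > x} + prob {\<omega>\<in>space M. \<exists>n. real n > b \<and> random_walk \<xi> n \<omega> \<le> x}"
proof -
  have [measurable]: "random_walk \<xi> n \<in> borel_measurable M" for n
    unfolding random_walk_def[abs_def] using rv by (intro borel_measurable_sum) auto
  note [measurable] = measurable_at_random_time[OF rv tau]
  let ?A = "{\<omega>\<in>space M. random_walk \<xi> (\<tau> \<omega>) \<omega> > x}"
    and ?B = "{\<omega>\<in>space M. \<exists>n. real n > b \<and> random_walk \<xi> n \<omega> \<le> x}"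
  have "prob {\<omega>\<in>space M. real (\<tau> \<omega>) > b} \<le> prob (?A \<union> ?B)"
  proof (rule finite_measure_mono)
    show "{\<omega>\<in>space M. real (\<tau> \<omega>) > b} \<subseteq> ?A \<union> ?B" by (auto simp: not_less)
  qed measurable
  also have "\<dots> \<le> prob ?A + prob ?B" by (intro measure_Un_le) measurable
  finally show ?thesis .
qed

lemma random_walk_tail_le_running_max:
  fixes \<xi> :: "nat \<Rightarrow> 'a \<Rightarrow> real"
  assumes rv: "\<And>n. n \<ge> 1 \<Longrightarrow> \<xi> n \<in> borel_measurable M" and tau [measurable]: "\<tau> \<in> measurable M (count_space UNIV)"
  shows "prob {\<omega>\<in>space M. random_walk \<xi> (\<tau> \<omega>) \<omega> > x} \<le> prob {\<omega>\<in>space M. running_max \<xi> (\<tau> \<omega>) \<omega> > x}"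
proof (rule finite_measure_mono)
  note [measurable] = measurable_at_random_time[OF rv tau]
  have "random_walk \<xi> n \<omega> \<le> running_max \<xi> n \<omega>" for n \<omega>
    unfolding running_max_def by (intro Max_ge) auto
  then show "{\<omega>\<in>space M. random_walk \<xi> (\<tau> \<omega>) \<omega> > x} \<subseteq> {\<omega>\<in>space M. running_max \<xi> (\<tau> \<omega>) \<omega> > x}"
    by (auto intro: less_le_trans)
  show "{\<omega>\<in>space M. running_max \<xi> (\<tau> \<omega>) \<omega> > x} \<in> events" by measurable
qed

end

theorem theorem4:
  fixes M :: "'a measure"
    and X :: "'a \<Rightarrow> real" and \<xi> :: "nat \<Rightarrow> 'a \<Rightarrow> real"
    and \<tau> :: "'a \<Rightarrow> nat" and a :: real
  assumes "prob_space M"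
    and indep: "prob_space.indep_vars M (\<lambda>_. borel) \<xi> {1..}"
    and ident: "\<And>n. n \<ge> 1 \<Longrightarrow> distr M borel (\<xi> n) = distr M borel X"
    and mean: "integrable M X" "a = (\<integral>\<omega>. X \<omega> \<partial>M)" "a > 0"
    and tau: "\<tau> \<in> measurable M (count_space UNIV)"
    and irv: "intermediate_regularly_varying (distr M borel (\<lambda>\<omega>. real (\<tau> \<omega>)))"
  defines "U \<equiv> (\<lambda>x. x * \<P>(\<omega> in M. X \<omega> > x)) \<in> o[at_top](\<lambda>x. \<P>(\<omega> in M. real (\<tau> \<omega>) > x))"
    and "L \<equiv> (\<lambda>x. LBINT y:{x<..}. \<P>(\<omega> in M. X \<omega> < - y))
               \<in> o[at_top](\<lambda>x. \<P>(\<omega> in M. real (\<tau> \<omega>) > x))"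
  shows "(U \<longrightarrow>
           asymp_le (\<lambda>x. \<P>(\<omega> in M. running_max \<xi> (\<tau> \<omega>) \<omega> > x))
                    (\<lambda>x. \<P>(\<omega> in M. real (\<tau> \<omega>) > x / a))) \<and>
         (L \<longrightarrow>
           asymp_ge (\<lambda>x. \<P>(\<omega> in M. random_walk \<xi> (\<tau> \<omega>) \<omega> > x))
                    (\<lambda>x. \<P>(\<omega> in M. real (\<tau> \<omega>) > x / a))) \<and>
         (U \<and> L \<longrightarrow>
           (\<lambda>x. \<P>(\<omega> in M. running_max \<xi> (\<tau> \<omega>) \<omega> > x))
             \<sim>[at_top] (\<lambda>x. \<P>(\<omega> in M. random_walk \<xi> (\<tau> \<omega>) \<omega> > x)) \<and>
           (\<lambda>x. \<P>(\<omega> in M. random_walk \<xi> (\<tau> \<omega>) \<omega> > x))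
             \<sim>[at_top] (\<lambda>x. \<P>(\<omega> in M. real (\<tau> \<omega>) > x / a)))"
proof -
  interpret prob_space M by fact
  define G where "G = distr M borel (\<lambda>\<omega>. real (\<tau> \<omega>))"
  define p where "p x = prob {\<omega>\<in>space M. real (\<tau> \<omega>) > x}" for x
  define g where "g x = p (x / a)" for x
  define PM where "PM x = prob {\<omega>\<in>space M. running_max \<xi> (\<tau> \<omega>) \<omega> > x}" for x
  define PS where "PS x = prob {\<omega>\<in>space M. random_walk \<xi> (\<tau> \<omega>) \<omega> > x}" for x
  note [measurable] = tau
  have rv: "\<xi> n \<in> borel_measurable M" if "n \<ge> 1" for n
    using indep that by (auto simp: indep_vars_def2)
  have tail_p: "tail G x = p x" for x unfolding G_def p_def by (rule tail_distr_real[OF tau])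
  have p_pos: "p x > 0" for x
    using irv by (simp add: intermediate_regularly_varying_def G_def[symmetric] tail_p)
  have p_anti: "antimono p"
    unfolding p_def by (intro antimonoI finite_measure_mono) auto
  have dil: "\<exists>\<epsilon>>0. \<epsilon> < 1 \<and> (\<forall>\<^sub>F x in at_top. p ((1 - \<epsilon>) * x) \<le> (1 + \<eta>) * p x)" if "\<eta> > 0" for \<eta>
    using irv_dilation[OF irv that] by (simp add: G_def[symmetric] tail_p)
  have p_dil: "dilation_bounded p"
  proof -
    obtain \<epsilon> where "\<epsilon> > 0" "\<epsilon> < 1" "\<forall>\<^sub>F x in at_top. p ((1 - \<epsilon>) * x) \<le> (1 + 1) * p x"
      using dil[of 1] by auto
    then show ?thesis by (intro dilation_boundedI[OF p_anti, of "1 - \<epsilon>"]) auto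
  qed
  have g_pos: "g x > 0" for x by (simp add: g_def p_pos)
  have upper: "\<forall>\<^sub>F x in at_top. PM x \<le> (1 + \<eta>) * g x" if U and "\<eta> > 0" for \<eta>
  proof -
    obtain \<epsilon> where \<epsilon>: "\<epsilon> > 0" "\<epsilon> < 1" "\<forall>\<^sub>F x in at_top. p ((1 - \<epsilon>) * x) \<le> (1 + \<eta> / 2) * p x"
      using dil[of "\<eta> / 2"] \<open>\<eta> > 0\<close> by auto
    have "filterlim (\<lambda>x::real. x / a) at_top at_top" using \<open>a > 0\<close> by real_asymp
    with \<epsilon>(3) have "\<forall>\<^sub>F x in at_top. p ((1 - \<epsilon>) * (x / a)) \<le> (1 + \<eta> / 2) * p (x / a)"
      by (rule eventually_compose_filterlim)
    moreover have "(\<lambda>x. x * prob {\<omega>\<in>space M. X \<omega> > x}) \<in> o[at_top](p)"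
      using \<open>U\<close> by (simp add: U_def p_def[abs_def])
    note smallo_undilate[OF p_pos p_dil early_passage_smallo[OF indep ident mean p_pos p_anti p_dil this \<epsilon>(1,2)] \<open>a > 0\<close>]
    from landau_o.smallD[OF this, of "\<eta> / 2"]
    have "\<forall>\<^sub>F x in at_top. prob {\<omega>\<in>space M. \<exists>n. real n \<le> (1 - \<epsilon>) * (x / a) \<and> x < random_walk \<xi> n \<omega>} \<le> \<eta> / 2 * p (x / a)"
      using \<open>\<eta> > 0\<close> p_pos by (simp add: abs_of_pos)
    ultimately show ?thesis
    proof eventually_elim
      case (elim x)
      have "PM x \<le> p ((1 - \<epsilon>) * (x / a)) + prob {\<omega>\<in>space M. \<exists>n. real n \<le> (1 - \<epsilon>) * (x / a) \<and> x < random_walk \<xi> n \<omega>}"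
        unfolding PM_def p_def by (rule running_max_tail_le[OF rv tau])
      then show ?case using elim by (simp add: g_def algebra_simps)
    qed
  qed
  have lower: "\<forall>\<^sub>F x in at_top. (1 - \<eta>) * g x \<le> PS x" if L and "\<eta> > 0" for \<eta>
  proof -
    obtain \<epsilon> where \<epsilon>: "\<epsilon> > 0" "\<epsilon> < 1" "\<forall>\<^sub>F x in at_top. p ((1 - \<epsilon>) * x) \<le> (1 + \<eta> / 2) * p x"
      using dil[of "\<eta> / 2"] \<open>\<eta> > 0\<close> by auto
    have "filterlim (\<lambda>x::real. x / (a * (1 - \<epsilon>))) at_top at_top"
      using \<open>a > 0\<close> \<epsilon> by (intro filterlim_at_top_mult_tendsto_pos[where c = "1 / (a * (1 - \<epsilon>))"
            and f = "\<lambda>_. 1 / (a * (1 - \<epsilon>))", simplified]) (auto simp: filterlim_ident)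
    (* The dilation bound at the point x / (a * (1 - \<epsilon>)), whose dilate is x / a. *)
    with \<epsilon>(3) have "\<forall>\<^sub>F x in at_top. p ((1 - \<epsilon>) * (x / (a * (1 - \<epsilon>)))) \<le> (1 + \<eta> / 2) * p (x / (a * (1 - \<epsilon>)))"
      by (rule eventually_compose_filterlim)
    then have "\<forall>\<^sub>F x in at_top. p (x / a) \<le> (1 + \<eta> / 2) * p (x / (a * (1 - \<epsilon>)))"
      using \<epsilon> by simp
    moreover have "(\<lambda>x. LBINT y:{x<..}. prob {\<omega>\<in>space M. X \<omega> < - y}) \<in> o[at_top](p)"
      using \<open>L\<close> by (simp add: L_def p_def[abs_def])
    note smallo_undilate[OF p_pos p_dil late_low_value_smallo[OF indep ident mean p_pos p_anti p_dil this \<epsilon>(1,2)] \<open>a > 0\<close>]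
    from landau_o.smallD[OF this, of "\<eta> / 2"]
    have "\<forall>\<^sub>F x in at_top. prob {\<omega>\<in>space M. \<exists>n. real n > x / (a * (1 - \<epsilon>)) \<and> random_walk \<xi> n \<omega> \<le> x} \<le> \<eta> / 2 * p (x / a)"
      using \<open>\<eta> > 0\<close> p_pos by (simp add: abs_of_pos)
    moreover have "\<forall>\<^sub>F x::real in at_top. 0 \<le> x" by (rule eventually_ge_at_top)
    ultimately show ?thesis
    proof eventually_elim
      case (elim x)
      let ?q = "p (x / (a * (1 - \<epsilon>)))"
      have "?q \<le> PS x + prob {\<omega>\<in>space M. \<exists>n. real n > x / (a * (1 - \<epsilon>)) \<and> random_walk \<xi> n \<omega> \<le> x}"
        unfolding PS_def p_def by (rule random_walk_tail_ge[OF rv tau])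
      then have le: "?q - \<eta> / 2 * p (x / a) \<le> PS x" using elim by linarith
      have "?q \<le> p (x / a)"
      proof (rule antimonoD[OF p_anti])
        have "x * (a * (1 - \<epsilon>)) \<le> x * a" using elim \<epsilon> \<open>a > 0\<close> by (intro mult_left_mono) auto
        then show "x / a \<le> x / (a * (1 - \<epsilon>))" using \<epsilon> \<open>a > 0\<close> by (simp add: frac_le_eq pos_divide_le_eq divide_le_eq le_divide_eq mult_ac)
      qed
      then have "\<eta> / 2 * ?q \<le> \<eta> / 2 * p (x / a)" using \<open>\<eta> > 0\<close> by (intro mult_left_mono) auto
      then have "p (x / a) - \<eta> / 2 * p (x / a) \<le> ?q" using elim by (simp add: algebra_simps)
      then show ?case using le by (simp add: g_def algebra_simps)
    qed
  qed
  have PS_PM: "PS x \<le> PM x" for x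
    unfolding PS_def PM_def by (rule random_walk_tail_le_running_max[OF rv tau])
  have "asymp_le PM g" if U using upper[OF that] g_pos by (intro asymp_leI) auto
  moreover have "asymp_ge PS g" if L using lower[OF that] g_pos by (intro asymp_geI) auto
  moreover have "PM \<sim>[at_top] PS \<and> PS \<sim>[at_top] g" if "U \<and> L"
  proof -
    have "PS \<sim>[at_top] g"
    proof (rule asymp_equiv_of_bounds[OF g_pos])
      fix \<eta> :: real assume "\<eta> > 0"
      show "\<forall>\<^sub>F x in at_top. PS x \<le> (1 + \<eta>) * g x"
        using upper[of \<eta>] that \<open>\<eta> > 0\<close> PS_PM by (auto elim!: eventually_mono intro: order_trans)
      show "\<forall>\<^sub>F x in at_top. (1 - \<eta>) * g x \<le> PS x" using lower[of \<eta>] that \<open>\<eta> > 0\<close> by auto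
    qed
    moreover have "PM \<sim>[at_top] g"
    proof (rule asymp_equiv_of_bounds[OF g_pos])
      fix \<eta> :: real assume "\<eta> > 0"
      show "\<forall>\<^sub>F x in at_top. PM x \<le> (1 + \<eta>) * g x" using upper[of \<eta>] that \<open>\<eta> > 0\<close> by auto
      show "\<forall>\<^sub>F x in at_top. (1 - \<eta>) * g x \<le> PM x"
        using lower[of \<eta>] that \<open>\<eta> > 0\<close> PS_PM by (auto elim!: eventually_mono intro: order_trans)
    qed
    ultimately show ?thesis by (meson asymp_equiv_trans asymp_equiv_sym)
  qed
  ultimately show ?thesis
    unfolding PM_def[abs_def] PS_def[abs_def] g_def[abs_def] p_def[abs_def] by blast
qed

end
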